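(* Let $n\ge2$, $0\le\kappa\le n-2$, $(\epsilon_1,\ldots,\epsilon_n)=(1^\kappa,0^{n-\kappa})$ ($\kappa$ ones followed by $n-\kappa$ zeros) and $l,m\in\mathbb Z_{\ge0}$. The $\mathcal U_A(1^\kappa,0^{n-\kappa})$-module $\mathcal W_l\otimes\mathcal W_m$ (with action $(\pi_x\otimes\pi_y)\Delta$) is irreducible.
   Context: $q^{1/2},x,y$ are generic (algebraically independent indeterminates over $\mathbb C$), vector spaces are over $\mathbb C(q^{1/2},x,y)$; $[m]=\frac{q^m-q^{-m}}{q-q^{-1}}$. $F$ has basis $|m\rangle$, $m\in\mathbb Z_{\ge0}$; $V$ has basis $|0\rangle,|1\rangle$; $\mathcal W=V^{\otimes\kappa}\otimes F^{\otimes(n-\kappa)}$ has basis $|\mathbf m\rangle=|m_1,\ldots,m_n\rangle$ ($m_i\in\{0,1\}$ for $i\le\kappa$, $m_i\in\mathbb Z_{\ge0}$ for $i>\kappa$); $\mathcal W_l$ is the span of $|\mathbf m\rangle$ with $m_1+\cdots+m_n=l$. $\mathbf e_i$ is the $i$th standard basis vector of $\mathbb Z^n$. $\mathcal U_A(\epsilon_1,\ldots,\epsilon_n)$: put $q_i=q$ if $\epsilon_i=0$ and $q_i=-q^{-1}$ if $\epsilon_i=1$; indices are in $\mathbb Z/n\mathbb Z$; $D_{i,j}=\prod_{k\in\{i,i+1\}\cap\{j,j+1\}}q_k^{2\delta_{i,j}-1}$. Generators $e_i,f_i,k_i^{\pm1}$ ($0\le i\le n-1$), relations $k_ik_i^{-1}=k_i^{-1}k_i=1$,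 $[k_i,k_j]=0$, $k_ie_j=D_{i,j}e_jk_i$, $k_if_j=D_{i,j}^{-1}f_jk_i$, $[e_i,f_j]=\delta_{i,j}\frac{k_i-k_i^{-1}}{q-q^{-1}}$; coproduct $\Delta k_i^{\pm1}=k_i^{\pm1}\otimes k_i^{\pm1}$, $\Delta e_i=1\otimes e_i+e_i\otimes k_i$, $\Delta f_i=f_i\otimes1+k_i^{-1}\otimes f_i$. Representation $\pi_x$ on $\mathcal W_l$ (vectors with indices out of range are zero): $e_i|\mathbf m\rangle=x^{\delta_{i,0}}[m_i]|\mathbf m-\mathbf e_i+\mathbf e_{i+1}\rangle$, $f_i|\mathbf m\rangle=x^{-\delta_{i,0}}[m_{i+1}]|\mathbf m+\mathbf e_i-\mathbf e_{i+1}\rangle$, $k_i|\mathbf m\rangle=q_i^{-m_i}q_{i+1}^{m_{i+1}}|\mathbf m\rangle$. *)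

theory Defs
  imports
    Complex_Main
    "HOL-Library.Poly_Mapping"
    "HOL-Library.Product_Plus"
    "HOL-Computational_Algebra.Polynomial"
    "HOL-Computational_Algebra.Fraction_Field"
begin

section \<open>The ground field\<close>

text \<open>The field of rational functions over the complex numbers in three indeterminates
  \<open>q\<^sup>1\<^sup>/\<^sup>2\<close>, \<open>x\<close>, \<open>y\<close>; the innermost polynomial variable is \<open>q\<^sup>1\<^sup>/\<^sup>2\<close>, the outermost is \<open>y\<close>.\<close>

type_synonym ground = "complex poly poly poly fract"

definition q_half :: ground where "q_half = Fract [:[:[:0, 1:]:]:] 1"
definition x_par :: ground where "x_par = Fract [:[:0, 1:]:] 1"
definition y_par :: ground where "y_par = Fract [:0, 1:] 1"

definition q_par :: ground where "q_par = q_half ^ 2"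

definition qint :: "int \<Rightarrow> ground" where
  "qint m = (q_par powi m - q_par powi (- m)) / (q_par - inverse q_par)"


section \<open>Vector spaces with a given basis\<close>

text \<open>\<open>'a \<Rightarrow>\<^sub>0 'k\<close> is the vector space with basis \<open>Poly_Mapping.single a 1\<close>.\<close>

definition pscale :: "'k::field \<Rightarrow> ('a \<Rightarrow>\<^sub>0 'k) \<Rightarrow> ('a \<Rightarrow>\<^sub>0 'k)" where
  "pscale c p = Poly_Mapping.map (\<lambda>a. c * a) p"

lemma lookup_pscale [simp]:
  "Poly_Mapping.lookup (pscale c p) k = c * Poly_Mapping.lookup p k"
  by (simp add: pscale_def map.rep_eq when_def)

global_interpretation pm: vector_space "pscale :: 'k::field \<Rightarrow> ('a \<Rightarrow>\<^sub>0 'k) \<Rightarrow> ('a \<Rightarrow>\<^sub>0 'k)"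
  by unfold_locales (auto intro!: poly_mapping_eqI simp: lookup_add algebra_simps)

text \<open>The linear map taking the basis vector of index \<open>a\<close> to \<open>f a\<close>.\<close>

definition lin_ext :: "('a \<Rightarrow> ('b \<Rightarrow>\<^sub>0 'k::field)) \<Rightarrow> ('a \<Rightarrow>\<^sub>0 'k) \<Rightarrow> ('b \<Rightarrow>\<^sub>0 'k)" where
  "lin_ext f p = (\<Sum>a\<in>Poly_Mapping.keys p. pscale (Poly_Mapping.lookup p a) (f a))"

text \<open>The tensor product of the spaces with bases indexed by \<open>'a\<close> and \<open>'b\<close> has its basis indexed
  by \<open>'a \<times> 'b\<close>.\<close>

definition tensor :: "('a \<Rightarrow>\<^sub>0 'k::field) \<Rightarrow> ('b \<Rightarrow>\<^sub>0 'k) \<Rightarrow> ('a \<times> 'b \<Rightarrow>\<^sub>0 'k)" where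
  "tensor u v = lin_ext (\<lambda>a. lin_ext (\<lambda>b. Poly_Mapping.single (a, b) 1) v) u"

definition tensor_space ::
    "('a \<Rightarrow>\<^sub>0 'k::field) set \<Rightarrow> ('b \<Rightarrow>\<^sub>0 'k) set \<Rightarrow> ('a \<times> 'b \<Rightarrow>\<^sub>0 'k) set" where
  "tensor_space V W = pm.span {tensor v w | v w. v \<in> V \<and> w \<in> W}"

definition tensor_map ::
    "(('a \<Rightarrow>\<^sub>0 'k::field) \<Rightarrow> ('c \<Rightarrow>\<^sub>0 'k)) \<Rightarrow> (('b \<Rightarrow>\<^sub>0 'k) \<Rightarrow> ('d \<Rightarrow>\<^sub>0 'k)) \<Rightarrow>
      ('a \<times> 'b \<Rightarrow>\<^sub>0 'k) \<Rightarrow> ('c \<times> 'd \<Rightarrow>\<^sub>0 'k)" where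
  "tensor_map A B = lin_ext (\<lambda>(a, b). tensor (A (Poly_Mapping.single a 1)) (B (Poly_Mapping.single b 1)))"


section \<open>The algebra \<open>U\<^sub>A(\<epsilon>\<^sub>1, \<dots>, \<epsilon>\<^sub>n)\<close>\<close>

datatype generator = E nat | F nat | K nat | Kinv nat

text \<open>The free monoid, written additively so that \<open>'g word \<Rightarrow>\<^sub>0 'k\<close> with the convolution product
  is the free associative algebra on \<open>'g\<close>, and \<open>'g word \<times> 'g word \<Rightarrow>\<^sub>0 'k\<close> is the tensor product
  of that algebra with itself.\<close>

datatype 'g word = Word (letters: "'g list")

instantiation word :: (type) monoid_add
begin

definition zero_word :: "'a word" where "zero_word = Word []"
definition plus_word :: "'a word \<Rightarrow> 'a word \<Rightarrow> 'a word" where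
  "plus_word u v = Word (letters u @ letters v)"

instance by standard (auto simp: zero_word_def plus_word_def)

end

type_synonym free_elt = "generator word \<Rightarrow>\<^sub>0 ground"

definition gen :: "generator \<Rightarrow> free_elt" where
  "gen g = Poly_Mapping.single (Word [g]) 1"

definition generators :: "nat \<Rightarrow> generator set" where
  "generators n = (\<Union>i<n. {E i, F i, K i, Kinv i})"

definition free_algebra :: "nat \<Rightarrow> free_elt set" where
  "free_algebra n = {a. \<forall>w\<in>Poly_Mapping.keys a. set (letters w) \<subseteq> generators n}"

text \<open>The representative in \<open>{1..n}\<close> of an index in \<open>\<int>/n\<int>\<close>; positions in
  \<open>(\<epsilon>\<^sub>1, \<dots>, \<epsilon>\<^sub>n)\<close> and \<open>(m\<^sub>1, \<dots>, m\<^sub>n)\<close> are numbered from 1 to \<open>n\<close>.\<close>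

definition pos :: "nat \<Rightarrow> nat \<Rightarrow> nat" where
  "pos n i = (if i mod n = 0 then n else i mod n)"

definition q_idx :: "nat \<Rightarrow> (nat \<Rightarrow> nat) \<Rightarrow> nat \<Rightarrow> ground" where
  "q_idx n \<epsilon> i = (if \<epsilon> (pos n i) = 0 then q_par else - inverse q_par)"

definition D_coeff :: "nat \<Rightarrow> (nat \<Rightarrow> nat) \<Rightarrow> nat \<Rightarrow> nat \<Rightarrow> ground" where
  "D_coeff n \<epsilon> i j =
     (\<Prod>k\<in>{pos n i, pos n (i + 1)} \<inter> {pos n j, pos n (j + 1)}.
        q_idx n \<epsilon> k powi (2 * (if i = j then 1 else 0) - 1))"

definition UA_relations :: "nat \<Rightarrow> (nat \<Rightarrow> nat) \<Rightarrow> free_elt set" where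
  "UA_relations n \<epsilon> =
     (\<Union>i<n. {gen (K i) * gen (Kinv i) - 1, gen (Kinv i) * gen (K i) - 1}) \<union>
     (\<Union>i<n. \<Union>j<n.
       {gen (K i) * gen (K j) - gen (K j) * gen (K i),
        gen (K i) * gen (E j) - pscale (D_coeff n \<epsilon> i j) (gen (E j) * gen (K i)),
        gen (K i) * gen (F j) - pscale (inverse (D_coeff n \<epsilon> i j)) (gen (F j) * gen (K i)),
        gen (E i) * gen (F j) - gen (F j) * gen (E i)
          - (if i = j then pscale (1 / (q_par - inverse q_par)) (gen (K i) - gen (Kinv i)) else 0)})"

text \<open>The two-sided ideal of \<open>A\<close> generated by \<open>R\<close>.\<close>

inductive_set two_sided_ideal :: "'r::ring_1 set \<Rightarrow> 'r set \<Rightarrow> 'r set" for A R where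
  zero: "0 \<in> two_sided_ideal A R"
| base: "r \<in> R \<Longrightarrow> r \<in> two_sided_ideal A R"
| add: "r \<in> two_sided_ideal A R \<Longrightarrow> s \<in> two_sided_ideal A R \<Longrightarrow> r + s \<in> two_sided_ideal A R"
| left: "a \<in> A \<Longrightarrow> r \<in> two_sided_ideal A R \<Longrightarrow> a * r \<in> two_sided_ideal A R"
| right: "a \<in> A \<Longrightarrow> r \<in> two_sided_ideal A R \<Longrightarrow> r * a \<in> two_sided_ideal A R"

definition UA_ideal :: "nat \<Rightarrow> (nat \<Rightarrow> nat) \<Rightarrow> free_elt set" where
  "UA_ideal n \<epsilon> = two_sided_ideal (free_algebra n) (UA_relations n \<epsilon>)"

text \<open>\<open>U\<^sub>A(\<epsilon>\<^sub>1, \<dots>, \<epsilon>\<^sub>n)\<close> is the quotient of \<open>free_algebra n\<close> by \<open>UA_ideal n \<epsilon>\<close>, so its modules are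
  the modules \<open>V\<close> over the free algebra that the ideal annihilates; \<open>\<rho> a v\<close> is the action of \<open>a\<close>
  on \<open>v\<close>.\<close>

definition UA_module ::
    "nat \<Rightarrow> (nat \<Rightarrow> nat) \<Rightarrow> (free_elt \<Rightarrow> ('b \<Rightarrow>\<^sub>0 ground) \<Rightarrow> ('b \<Rightarrow>\<^sub>0 ground)) \<Rightarrow>
      ('b \<Rightarrow>\<^sub>0 ground) set \<Rightarrow> bool" where
  "UA_module n \<epsilon> \<rho> V \<longleftrightarrow>
     pm.subspace V \<and>
     (\<forall>a\<in>free_algebra n. \<forall>v\<in>V. \<rho> a v \<in> V) \<and>
     (\<forall>a\<in>free_algebra n. \<forall>v\<in>V. \<forall>w\<in>V. \<rho> a (v + w) = \<rho> a v + \<rho> a w) \<and>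
     (\<forall>a\<in>free_algebra n. \<forall>c. \<forall>v\<in>V. \<rho> a (pscale c v) = pscale c (\<rho> a v)) \<and>
     (\<forall>a\<in>free_algebra n. \<forall>b\<in>free_algebra n. \<forall>v\<in>V. \<rho> (a + b) v = \<rho> a v + \<rho> b v) \<and>
     (\<forall>a\<in>free_algebra n. \<forall>c. \<forall>v\<in>V. \<rho> (pscale c a) v = pscale c (\<rho> a v)) \<and>
     (\<forall>v\<in>V. \<rho> 1 v = v) \<and>
     (\<forall>a\<in>free_algebra n. \<forall>b\<in>free_algebra n. \<forall>v\<in>V. \<rho> (a * b) v = \<rho> a (\<rho> b v)) \<and>
     (\<forall>a\<in>UA_ideal n \<epsilon>. \<forall>v\<in>V. \<rho> a v = 0)"

definition UA_submodule ::
    "nat \<Rightarrow> (free_elt \<Rightarrow> ('b \<Rightarrow>\<^sub>0 ground) \<Rightarrow> ('b \<Rightarrow>\<^sub>0 ground)) \<Rightarrow>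
      ('b \<Rightarrow>\<^sub>0 ground) set \<Rightarrow> ('b \<Rightarrow>\<^sub>0 ground) set \<Rightarrow> bool" where
  "UA_submodule n \<rho> V U \<longleftrightarrow>
     pm.subspace U \<and> U \<subseteq> V \<and> (\<forall>a\<in>free_algebra n. \<forall>u\<in>U. \<rho> a u \<in> U)"

definition UA_irreducible ::
    "nat \<Rightarrow> (nat \<Rightarrow> nat) \<Rightarrow> (free_elt \<Rightarrow> ('b \<Rightarrow>\<^sub>0 ground) \<Rightarrow> ('b \<Rightarrow>\<^sub>0 ground)) \<Rightarrow>
      ('b \<Rightarrow>\<^sub>0 ground) set \<Rightarrow> bool" where
  "UA_irreducible n \<epsilon> \<rho> V \<longleftrightarrow>
     UA_module n \<epsilon> \<rho> V \<and> V \<noteq> {0} \<and> (\<forall>U. UA_submodule n \<rho> V U \<longrightarrow> U = {0} \<or> U = V)"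


section \<open>The coproduct\<close>

fun coproduct_gen :: "generator \<Rightarrow> (generator word \<times> generator word \<Rightarrow>\<^sub>0 ground)" where
  "coproduct_gen (E i) = tensor 1 (gen (E i)) + tensor (gen (E i)) (gen (K i))"
| "coproduct_gen (F i) = tensor (gen (F i)) 1 + tensor (gen (Kinv i)) (gen (F i))"
| "coproduct_gen (K i) = tensor (gen (K i)) (gen (K i))"
| "coproduct_gen (Kinv i) = tensor (gen (Kinv i)) (gen (Kinv i))"

definition coproduct :: "free_elt \<Rightarrow> (generator word \<times> generator word \<Rightarrow>\<^sub>0 ground)" where
  "coproduct = lin_ext (\<lambda>w. prod_list (List.map coproduct_gen (letters w)))"

text \<open>\<open>(\<rho> \<otimes> \<sigma>)\<Delta>\<close>\<close>

definition tensor_action ::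
    "(free_elt \<Rightarrow> ('b \<Rightarrow>\<^sub>0 ground) \<Rightarrow> ('b \<Rightarrow>\<^sub>0 ground)) \<Rightarrow>
     (free_elt \<Rightarrow> ('c \<Rightarrow>\<^sub>0 ground) \<Rightarrow> ('c \<Rightarrow>\<^sub>0 ground)) \<Rightarrow>
     free_elt \<Rightarrow> ('b \<times> 'c \<Rightarrow>\<^sub>0 ground) \<Rightarrow> ('b \<times> 'c \<Rightarrow>\<^sub>0 ground)" where
  "tensor_action \<rho> \<sigma> a p =
     lin_ext (\<lambda>(u, v). tensor_map (\<rho> (Poly_Mapping.single u 1)) (\<sigma> (Poly_Mapping.single v 1)) p)
       (coproduct a)"


section \<open>The representation \<open>\<pi>\<^sub>z\<close>\<close>

text \<open>Multi-indices \<open>(m\<^sub>1, \<dots>, m\<^sub>n)\<close> are integer vectors supported on \<open>{1..n}\<close>.\<close>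

type_synonym multi_index = "nat \<Rightarrow> int"

definition valid_index :: "nat \<Rightarrow> nat \<Rightarrow> multi_index \<Rightarrow> bool" where
  "valid_index n \<kappa> m \<longleftrightarrow>
     (\<forall>i. i \<notin> {1..n} \<longrightarrow> m i = 0) \<and> (\<forall>i\<in>{1..n}. 0 \<le> m i) \<and> (\<forall>i\<in>{1..\<kappa>}. m i \<le> 1)"

definition ket :: "nat \<Rightarrow> nat \<Rightarrow> multi_index \<Rightarrow> (multi_index \<Rightarrow>\<^sub>0 ground)" where
  "ket n \<kappa> m = (if valid_index n \<kappa> m then Poly_Mapping.single m 1 else 0)"

definition W_space :: "nat \<Rightarrow> nat \<Rightarrow> nat \<Rightarrow> (multi_index \<Rightarrow>\<^sub>0 ground) set" where
  "W_space n \<kappa> l = pm.span {ket n \<kappa> m | m. valid_index n \<kappa> m \<and> (\<Sum>i=1..n. m i) = int l}"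

definition unit_vec :: "nat \<Rightarrow> multi_index" where
  "unit_vec i = (\<lambda>j. if j = i then 1 else 0)"

definition ones_zeros :: "nat \<Rightarrow> nat \<Rightarrow> nat" where
  "ones_zeros \<kappa> i = (if i \<le> \<kappa> then 1 else 0)"

fun pi_gen ::
    "nat \<Rightarrow> nat \<Rightarrow> ground \<Rightarrow> generator \<Rightarrow> multi_index \<Rightarrow> (multi_index \<Rightarrow>\<^sub>0 ground)" where
  "pi_gen n \<kappa> z (E i) m =
     pscale ((if i = 0 then z else 1) * qint (m (pos n i)))
       (ket n \<kappa> (\<lambda>j. m j - unit_vec (pos n i) j + unit_vec (pos n (i + 1)) j))"
| "pi_gen n \<kappa> z (F i) m =
     pscale ((if i = 0 then inverse z else 1) * qint (m (pos n (i + 1))))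
       (ket n \<kappa> (\<lambda>j. m j + unit_vec (pos n i) j - unit_vec (pos n (i + 1)) j))"
| "pi_gen n \<kappa> z (K i) m =
     pscale (q_idx n (ones_zeros \<kappa>) i powi (- m (pos n i)) *
             q_idx n (ones_zeros \<kappa>) (i + 1) powi m (pos n (i + 1)))
       (ket n \<kappa> m)"
| "pi_gen n \<kappa> z (Kinv i) m =
     pscale (inverse (q_idx n (ones_zeros \<kappa>) i powi (- m (pos n i)) *
                      q_idx n (ones_zeros \<kappa>) (i + 1) powi m (pos n (i + 1))))
       (ket n \<kappa> m)"

definition pi_rep ::
    "nat \<Rightarrow> nat \<Rightarrow> ground \<Rightarrow> free_elt \<Rightarrow> (multi_index \<Rightarrow>\<^sub>0 ground) \<Rightarrow> (multi_index \<Rightarrow>\<^sub>0 ground)" where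
  "pi_rep n \<kappa> z a v =
     lin_ext (\<lambda>w. foldr (\<lambda>g. lin_ext (pi_gen n \<kappa> z g)) (letters w) v) a"

end

theory Submission
  imports Defs
begin

text \<open>Irreducibility comes from letting \<open>y\<close> tend to infinity. Measure the ground field by
  the absolute value \<open>|r| = 2\<^sup>n\<^sup>d\<close>, where \<open>d\<close> is the degree of \<open>r\<close> in \<open>y\<close>. Then \<open>q\<close>, \<open>x\<close> and the
  quantum integers \<open>[k]\<close>, \<open>k > 0\<close>, have absolute value 1, while \<open>|y| = 2\<^sup>n\<close>. Give the basis vector \<open>|a> \<otimes> |b>\<close> the weight \<open>2\<close> to the power \<open>\<Sum> j b\<^sub>j\<close>. Moving a particle
  of \<open>b\<close> from site \<open>i\<close> to \<open>i + 1\<close> doubles the weight; moving it from \<open>n\<close> to \<open>1\<close> divides it by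
  \<open>2\<^sup>n\<^sup>-\<^sup>1\<close>, which the factor \<open>y\<close> of \<open>e\<^sub>0\<close> again turns into a doubling. Hence \<open>1 \<otimes> e\<^sub>i\<close> doubles sizes
  for every \<open>i\<close>, while the other term \<open>e\<^sub>i \<otimes> k\<^sub>i\<close> of the coproduct does not increase them; likewise
  \<open>f\<^sub>i \<otimes> 1\<close> keeps sizes while \<open>k\<^sub>i\<^sup>-\<^sup>1 \<otimes> f\<^sub>i\<close> halves them. To leading order \<open>e\<^sub>i\<close> therefore acts on the
  second factor only and \<open>f\<^sub>i\<close> on the first only.

  A leading operator kills some basis vectors and sends the others to nonzero multiples of
  pairwise distinct basis vectors. Leading terms thus never cancel, and the set of basis vectors at which a vector
  has maximal size is simply moved along (\<open>leading_image\<close>). Let \<open>U\<close> be a nonzero submodule. Pushing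
  the particles of the second factor to site \<open>n\<close> with \<open>e\<^sub>1, \<dots>, e\<^sub>n\<^sub>-\<^sub>1\<close>, and those of the first
  with \<open>f\<^sub>0, \<dots>, f\<^sub>n\<^sub>-\<^sub>2\<close>, yields a vector of \<open>U\<close> that is dominated by the single basis vector with
  all particles at \<open>n\<close>. As particles move around a cycle, every basis vector can be reached from
  this one, so each of them dominates some vector of \<open>U\<close> (\<open>invariant_subspace_eq_all\<close>). Vectors
  dominated by pairwise distinct basis vectors are linearly independent, and counting dimensions
  gives that \<open>U\<close> is everything (\<open>ex_single_leading_imp_all\<close>).

  That the tensor product is a module at all follows from the multiplicativity of the coproduct
  (\<open>tensor_action_mult\<close>) and from the relations for \<open>\<pi>\<^sub>z\<close>. Since \<open>e\<^sub>i\<close> and \<open>f\<^sub>i\<close> both move one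
  particle to a neighbouring site and differ only in the direction, these relations reduce to the
  composition of two such hops (\<open>hop_hop\<close>, \<open>hop_commute\<close>, \<open>hop_commutator\<close>).\<close>

section \<open>Linear maps between spaces with bases\<close>

abbreviation plinear :: "(('a \<Rightarrow>\<^sub>0 'k::field) \<Rightarrow> ('b \<Rightarrow>\<^sub>0 'k)) \<Rightarrow> bool" where
  "plinear \<equiv> Vector_Spaces.linear pscale pscale"

lemma plinearI:
  assumes "\<And>u v. A (u + v) = A u + A v" and "\<And>c v. A (pscale c v) = pscale c (A v)"
  shows "plinear A"
  using assms by (auto simp: Vector_Spaces.linear_iff pm.vector_space_axioms)

lemma plinearD:
  assumes "plinear A"
  shows "A (u + v) = A u + A v" and "A (pscale c v) = pscale c (A v)"
    and "A 0 = 0" and "A (- v) = - A v" and "A (u - v) = A u - A v"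
    and "A (\<Sum>i\<in>I. g i) = (\<Sum>i\<in>I. A (g i))"
proof -
  interpret A: Vector_Spaces.linear pscale pscale A by fact
  show "A (u + v) = A u + A v" "A (pscale c v) = pscale c (A v)" "A 0 = 0"
    "A (- v) = - A v" "A (u - v) = A u - A v" "A (\<Sum>i\<in>I. g i) = (\<Sum>i\<in>I. A (g i))"
    by (fact A.add A.scale A.zero A.neg A.diff A.sum)+
qed

lemma plinear_id: "plinear (\<lambda>v. v)"
  by (rule plinearI) auto

lemma plinear_compose: "plinear A \<Longrightarrow> plinear B \<Longrightarrow> plinear (\<lambda>v. A (B v))"
  by (rule plinearI) (simp_all add: plinearD)

lemma lookup_lin_ext:
  "Poly_Mapping.lookup (lin_ext f p) b =
     (\<Sum>a\<in>Poly_Mapping.keys p. Poly_Mapping.lookup p a * Poly_Mapping.lookup (f a) b)"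
  by (simp add: lin_ext_def lookup_sum)

lemma lin_ext_superset:
  assumes "finite S" "Poly_Mapping.keys p \<subseteq> S"
  shows "lin_ext f p = (\<Sum>a\<in>S. pscale (Poly_Mapping.lookup p a) (f a))"
  unfolding lin_ext_def using assms
  by (intro sum.mono_neutral_left) (auto simp: in_keys_iff)

lemma plinear_lin_ext:
  fixes f :: "'a \<Rightarrow> ('b \<Rightarrow>\<^sub>0 'k::field)"
  shows "plinear (lin_ext f)"
proof (rule plinearI)
  fix u v :: "'a \<Rightarrow>\<^sub>0 'k" and c :: 'k
  let ?S = "Poly_Mapping.keys u \<union> Poly_Mapping.keys v"
  have S: "finite ?S" "Poly_Mapping.keys u \<subseteq> ?S" "Poly_Mapping.keys v \<subseteq> ?S"
    "Poly_Mapping.keys (u + v) \<subseteq> ?S"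
    using Poly_Mapping.keys_add[of u v] by auto
  show "lin_ext f (u + v) = lin_ext f u + lin_ext f v"
    by (simp add: lin_ext_superset[OF S(1,2)] lin_ext_superset[OF S(1,3)]
        lin_ext_superset[OF S(1,4)] lookup_add pm.scale_left_distrib sum.distrib)
  have k: "Poly_Mapping.keys (pscale c v) \<subseteq> Poly_Mapping.keys v"
    by (auto simp: in_keys_iff)
  show "lin_ext f (pscale c v) = pscale c (lin_ext f v)"
    using lin_ext_superset[OF finite_keys k, of f] by (simp add: lin_ext_def pm.scale_sum_right)
qed

lemma lin_ext_single [simp]: "lin_ext f (Poly_Mapping.single a c) = pscale c (f a)"
  by (cases "c = 0") (simp_all add: lin_ext_def)

lemma lin_ext_basis: "lin_ext (\<lambda>a. Poly_Mapping.single a 1) p = p"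
proof (rule poly_mapping_eqI)
  fix b
  show "Poly_Mapping.lookup (lin_ext (\<lambda>a. Poly_Mapping.single a 1) p) b = Poly_Mapping.lookup p b"
    by (cases "b \<in> Poly_Mapping.keys p")
      (auto simp: lookup_lin_ext lookup_single when_def in_keys_iff sum.delta
        if_distrib[of "(*) _"] cong: if_cong)
qed

lemma plinear_eq_lin_ext:
  assumes "plinear A"
  shows "A p = lin_ext (\<lambda>a. A (Poly_Mapping.single a 1)) p"
proof -
  have "A p = A (lin_ext (\<lambda>a. Poly_Mapping.single a 1) p)" by (simp only: lin_ext_basis)
  thus ?thesis by (simp add: lin_ext_def plinearD[OF assms])
qed

lemma plinear_eqI:
  assumes "plinear A" "plinear B"
    and "\<And>a. A (Poly_Mapping.single a 1) = B (Poly_Mapping.single a 1)"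
  shows "A p = B p"
  using plinear_eq_lin_ext[OF assms(1), of p] plinear_eq_lin_ext[OF assms(2), of p] assms(3) by simp

lemma plinear_eq_on_span:
  assumes "plinear A" "plinear B" and "\<And>v. v \<in> S \<Longrightarrow> A v = B v" and "v \<in> pm.span S"
  shows "A v = B v"
  using assms(4)
  by (induction rule: pm.span_induct_alt)
    (simp_all add: plinearD[OF assms(1)] plinearD[OF assms(2)] assms(3))

lemma plinear_span_subset:
  assumes "plinear A" "pm.subspace W" "\<And>v. v \<in> S \<Longrightarrow> A v \<in> W" "v \<in> pm.span S"
  shows "A v \<in> W"
  using assms(4)
  by (induction rule: pm.span_induct_alt)
    (simp_all add: plinearD[OF assms(1)] assms(3) pm.subspace_0[OF assms(2)]
      pm.subspace_add[OF assms(2)] pm.subspace_scale[OF assms(2)])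

lemma lookup_tensor [simp]:
  "Poly_Mapping.lookup (tensor u v) (a, b) = Poly_Mapping.lookup u a * Poly_Mapping.lookup v b"
proof -
  have "Poly_Mapping.lookup (lin_ext (\<lambda>b. Poly_Mapping.single (a', b) 1) v) (a, b) =
    (if a' = a then Poly_Mapping.lookup v b else 0)" for a'
    by (cases "b \<in> Poly_Mapping.keys v")
      (auto simp: lookup_lin_ext lookup_single when_def in_keys_iff sum.delta
        if_distrib[of "(*) _"] cong: if_cong)
  thus ?thesis
    by (cases "a \<in> Poly_Mapping.keys u")
      (auto simp: tensor_def lookup_lin_ext[of _ u] in_keys_iff
        if_distrib[of "(*) _"] cong: if_cong)
qed

lemma poly_mapping_eqI_prod:
  "(\<And>a b. Poly_Mapping.lookup p (a, b) = Poly_Mapping.lookup q (a, b)) \<Longrightarrow> p = q"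
  by (rule poly_mapping_eqI) auto

lemma tensor_bilinear:
  "tensor (u + u') v = tensor u v + tensor u' v" "tensor u (v + v') = tensor u v + tensor u v'"
  "tensor (u - u') v = tensor u v - tensor u' v" "tensor u (v - v') = tensor u v - tensor u v'"
  "tensor (pscale c u) v = pscale c (tensor u v)" "tensor u (pscale c v) = pscale c (tensor u v)"
  "tensor 0 v = 0" "tensor u 0 = 0"
  by (rule poly_mapping_eqI_prod; simp add: lookup_add lookup_minus algebra_simps)+

lemma tensor_single [simp]:
  "tensor (Poly_Mapping.single a c) (Poly_Mapping.single b d) = Poly_Mapping.single (a, b) (c * d)"
  by (rule poly_mapping_eqI_prod) (auto simp: lookup_single when_def)

lemma plinear_tensor_left: "plinear (\<lambda>u. tensor u v)"
  and plinear_tensor_right: "plinear (tensor u)"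
  by (rule plinearI; simp add: tensor_bilinear)+

lemma plinear_tensor_map: "plinear (tensor_map A B)"
  unfolding tensor_map_def by (rule plinear_lin_ext)

lemma tensor_map_tensor:
  fixes A :: "('a \<Rightarrow>\<^sub>0 'k::field) \<Rightarrow> ('c \<Rightarrow>\<^sub>0 'k)" and B :: "('b \<Rightarrow>\<^sub>0 'k) \<Rightarrow> ('d \<Rightarrow>\<^sub>0 'k)"
  assumes "plinear A" "plinear B"
  shows "tensor_map A B (tensor u v) = tensor (A u) (B v)"
proof (rule plinear_eqI[where A = "\<lambda>u. tensor_map A B (tensor u v)"])
  show "plinear (\<lambda>u. tensor_map A B (tensor u v))" "plinear (\<lambda>u. tensor (A u) (B v))"
    by (intro plinear_compose[OF plinear_tensor_map plinear_tensor_left]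
        plinear_compose[OF plinear_tensor_left assms(1)])+
next
  fix a :: 'a
  let ?a = "Poly_Mapping.single a (1 :: 'k)"
  show "tensor_map A B (tensor ?a v) = tensor (A ?a) (B v)"
  proof (rule plinear_eqI[where A = "\<lambda>v. tensor_map A B (tensor ?a v)"])
    show "plinear (\<lambda>v. tensor_map A B (tensor ?a v))" "plinear (\<lambda>v. tensor (A ?a) (B v))"
      by (intro plinear_compose[OF plinear_tensor_map plinear_tensor_right]
          plinear_compose[OF plinear_tensor_right assms(2)])+
  next
    fix b
    show "tensor_map A B (tensor ?a (Poly_Mapping.single b 1)) =
        tensor (A ?a) (B (Poly_Mapping.single b 1))"
      by (simp add: tensor_map_def)
  qed
qed

lemma tensor_map_compose:
  assumes "plinear A" "plinear B"
  shows "tensor_map (\<lambda>v. A (C v)) (\<lambda>v. B (D v)) p = tensor_map A B (tensor_map C D p)"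
  by (rule plinear_eqI[where A = "tensor_map (\<lambda>v. A (C v)) (\<lambda>v. B (D v))"])
    (auto simp: plinear_tensor_map tensor_map_def[of C D] tensor_map_def[of "\<lambda>v. A (C v)"]
      tensor_map_tensor assms
      intro!: plinear_compose[OF plinear_tensor_map plinear_lin_ext] plinear_lin_ext)

lemma tensor_map_id: "tensor_map (\<lambda>v. v) (\<lambda>v. v) p = p"
  by (rule plinear_eqI[OF plinear_tensor_map plinear_id]) (simp add: tensor_map_def)

section \<open>The coproduct is multiplicative\<close>

lemma pscale_eq_mult:
  fixes p :: "'a::monoid_add \<Rightarrow>\<^sub>0 'k::field"
  shows "pscale c p = Poly_Mapping.single 0 c * p" and "pscale c p = p * Poly_Mapping.single 0 c"
proof -
  have s: "pscale c (Poly_Mapping.single a d) = Poly_Mapping.single a (c * d)"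
    for a :: 'a and c d by (rule poly_mapping_eqI) (simp add: lookup_single when_def)
  have p: "p = (\<Sum>a\<in>Poly_Mapping.keys p. Poly_Mapping.single a (Poly_Mapping.lookup p a))"
    using lin_ext_basis[of p, symmetric] by (simp add: lin_ext_def s)
  show "pscale c p = Poly_Mapping.single 0 c * p"
    by (subst (1 2) p) (simp add: pm.scale_sum_right s sum_distrib_left mult_single)
  show "pscale c p = p * Poly_Mapping.single 0 c"
    by (subst (1 2) p)
      (simp add: pm.scale_sum_right s sum_distrib_right mult_single mult.commute)
qed

lemma pscale_mult:
  fixes p q :: "'a::monoid_add \<Rightarrow>\<^sub>0 'k::field"
  shows "pscale c p * q = pscale c (p * q)" and "p * pscale c q = pscale c (p * q)"
  by (simp add: pscale_eq_mult(1) mult.assoc) (simp add: pscale_eq_mult(2) mult.assoc)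

lemma plinear_mult_left: "plinear (\<lambda>p. p * (q :: 'a::monoid_add \<Rightarrow>\<^sub>0 'k::field))"
  and plinear_mult_right: "plinear (\<lambda>p. (q :: 'a::monoid_add \<Rightarrow>\<^sub>0 'k::field) * p)"
  by (rule plinearI; simp add: pscale_mult algebra_simps)+

lemma plinear_bilinear_eqI:
  assumes "\<And>q. plinear (\<lambda>p. A p q)" "\<And>q. plinear (\<lambda>p. B p q)"
    and "\<And>p. plinear (A p)" "\<And>p. plinear (B p)"
    and "\<And>a b. A (Poly_Mapping.single a 1) (Poly_Mapping.single b 1) =
               B (Poly_Mapping.single a 1) (Poly_Mapping.single b 1)"
  shows "A p q = B p q"
  by (rule plinear_eqI[OF assms(1,2)], rule plinear_eqI[OF assms(3,4)], rule assms(5))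

lemma plinear_coproduct: "plinear coproduct"
  unfolding coproduct_def by (rule plinear_lin_ext)

lemma coproduct_mult: "coproduct (a * b) = coproduct a * coproduct b"
proof (rule plinear_bilinear_eqI[where A = "\<lambda>a b. coproduct (a * b)"])
  show "plinear (\<lambda>p. coproduct (p * q))" "plinear (\<lambda>p. coproduct (q * p))"
    "plinear (\<lambda>p. coproduct p * coproduct q)" "plinear (\<lambda>p. coproduct q * coproduct p)" for q
    by (intro plinear_compose[OF plinear_coproduct plinear_mult_left]
        plinear_compose[OF plinear_coproduct plinear_mult_right]
        plinear_compose[OF plinear_mult_left plinear_coproduct]
        plinear_compose[OF plinear_mult_right plinear_coproduct])+
qed (simp add: coproduct_def mult_single plus_word_def)

lemma lin_ext_one: "lin_ext f (1 :: 'a::monoid_add \<Rightarrow>\<^sub>0 'k::field) = f 0"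
  using lin_ext_single[of f "0 :: 'a" 1] by simp

lemma coproduct_one: "coproduct 1 = 1"
  by (simp add: coproduct_def lin_ext_one zero_word_def)

lemma coproduct_gen: "coproduct (gen g) = coproduct_gen g"
  by (simp add: coproduct_def gen_def)

text \<open>The tensor product of two actions lets both of them act by single words only, so
  multiplicativity on words is all that is asked of them.\<close>

locale word_action =
  fixes \<rho> :: "free_elt \<Rightarrow> ('b \<Rightarrow>\<^sub>0 ground) \<Rightarrow> ('b \<Rightarrow>\<^sub>0 ground)"
  assumes plinear_word: "plinear (\<rho> (Poly_Mapping.single w 1))"
    and word_zero: "\<rho> (Poly_Mapping.single 0 1) v = v"
    and word_plus: "\<rho> (Poly_Mapping.single (u + w) 1) v =
          \<rho> (Poly_Mapping.single u 1) (\<rho> (Poly_Mapping.single w 1) v)"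

locale word_action_pair = A: word_action \<rho> + B: word_action \<sigma> for \<rho> \<sigma>
begin

lemma plinear_tensor_action_left: "plinear (\<lambda>a. tensor_action \<rho> \<sigma> a p)"
  unfolding tensor_action_def by (rule plinear_compose[OF plinear_lin_ext plinear_coproduct])

lemma plinear_lin_ext_param:
  assumes "\<And>a. plinear (\<lambda>p. f p a)"
  shows "plinear (\<lambda>p. lin_ext (f p) P)"
  by (rule plinearI)
    (simp_all add: lin_ext_def plinearD[OF assms] pm.scale_right_distrib sum.distrib
      pm.scale_sum_right mult.commute)

lemma plinear_word_pair: "plinear (\<lambda>p. (case a of (u, v) \<Rightarrow>
    tensor_map (\<rho> (Poly_Mapping.single u 1)) (\<sigma> (Poly_Mapping.single v 1)) p))"
  by (cases a) (simp add: plinear_tensor_map)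

lemma plinear_tensor_action: "plinear (tensor_action \<rho> \<sigma> a)"
  unfolding tensor_action_def by (rule plinear_lin_ext_param, rule plinear_word_pair)

text \<open>Both sides are bilinear in the images of \<open>a\<close> and \<open>b\<close> under the coproduct, so that it
  suffices to compare them on pairs of words.\<close>

lemma tensor_action_mult:
  "tensor_action \<rho> \<sigma> (a * b) p = tensor_action \<rho> \<sigma> a (tensor_action \<rho> \<sigma> b p)"
proof -
  define act where "act P p = lin_ext (\<lambda>(u, v).
    tensor_map (\<rho> (Poly_Mapping.single u 1)) (\<sigma> (Poly_Mapping.single v 1)) p) P" for P p
  have lin1: "plinear (\<lambda>P. act P p)" for p
    unfolding act_def by (rule plinear_lin_ext)
  have lin2: "plinear (act P)" for P
    unfolding act_def by (rule plinear_lin_ext_param, rule plinear_word_pair)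
  have "act (P * Q) p = act P (act Q p)" for P Q
  proof (rule plinear_bilinear_eqI[where A = "\<lambda>P Q. act (P * Q) p"])
    show "plinear (\<lambda>P. act (P * Q) p)" "plinear (\<lambda>P. act (Q * P) p)"
      "plinear (\<lambda>P. act P (act Q p))" "plinear (\<lambda>P. act Q (act P p))" for Q
      by (intro lin1 plinear_compose[OF lin1 plinear_mult_left]
          plinear_compose[OF lin1 plinear_mult_right] plinear_compose[OF lin2 lin1])+
    fix a b :: "generator word \<times> generator word"
    have "\<rho> (Poly_Mapping.single (u + w) 1) =
        (\<lambda>v. \<rho> (Poly_Mapping.single u 1) (\<rho> (Poly_Mapping.single w 1) v))"
      "\<sigma> (Poly_Mapping.single (u + w) 1) =
        (\<lambda>v. \<sigma> (Poly_Mapping.single u 1) (\<sigma> (Poly_Mapping.single w 1) v))" for u w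
      using A.word_plus B.word_plus by auto
    moreover obtain u v u' v' where ab: "a = (u, v)" "b = (u', v')" by (cases a, cases b)
    ultimately show "act (Poly_Mapping.single a 1 * Poly_Mapping.single b 1) p =
      act (Poly_Mapping.single a 1) (act (Poly_Mapping.single b 1) p)"
      by (simp add: ab act_def mult_single tensor_map_compose A.plinear_word B.plinear_word)
  qed
  thus ?thesis by (simp add: tensor_action_def coproduct_mult act_def)
qed

lemma tensor_action_one: "tensor_action \<rho> \<sigma> 1 p = p"
proof -
  have "\<rho> (Poly_Mapping.single 0 1) = (\<lambda>v. v)" "\<sigma> (Poly_Mapping.single 0 1) = (\<lambda>v. v)"
    using A.word_zero B.word_zero by auto
  thus ?thesis
    by (simp add: tensor_action_def coproduct_one lin_ext_one zero_prod_def tensor_map_id)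
qed

lemma tensor_action_gen:
  "tensor_action \<rho> \<sigma> (gen (E i)) (tensor v w) =
     tensor v (\<sigma> (gen (E i)) w) + tensor (\<rho> (gen (E i)) v) (\<sigma> (gen (K i)) w)"
  "tensor_action \<rho> \<sigma> (gen (F i)) (tensor v w) =
     tensor (\<rho> (gen (F i)) v) w + tensor (\<rho> (gen (Kinv i)) v) (\<sigma> (gen (F i)) w)"
  "tensor_action \<rho> \<sigma> (gen (K i)) (tensor v w) =
     tensor (\<rho> (gen (K i)) v) (\<sigma> (gen (K i)) w)"
  "tensor_action \<rho> \<sigma> (gen (Kinv i)) (tensor v w) =
     tensor (\<rho> (gen (Kinv i)) v) (\<sigma> (gen (Kinv i)) w)"
proof -
  have one: "(1 :: free_elt) = Poly_Mapping.single 0 1" by simp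
  show
  "tensor_action \<rho> \<sigma> (gen (E i)) (tensor v w) =
     tensor v (\<sigma> (gen (E i)) w) + tensor (\<rho> (gen (E i)) v) (\<sigma> (gen (K i)) w)"
  "tensor_action \<rho> \<sigma> (gen (F i)) (tensor v w) =
     tensor (\<rho> (gen (F i)) v) w + tensor (\<rho> (gen (Kinv i)) v) (\<sigma> (gen (F i)) w)"
  "tensor_action \<rho> \<sigma> (gen (K i)) (tensor v w) =
     tensor (\<rho> (gen (K i)) v) (\<sigma> (gen (K i)) w)"
  "tensor_action \<rho> \<sigma> (gen (Kinv i)) (tensor v w) =
     tensor (\<rho> (gen (Kinv i)) v) (\<sigma> (gen (Kinv i)) w)"
    unfolding tensor_action_def coproduct_gen coproduct_gen.simps
      plinearD(1)[OF plinear_lin_ext] unfolding one unfolding gen_def tensor_single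
    by (simp_all del: single_one add: tensor_map_tensor A.plinear_word B.plinear_word
        A.word_zero B.word_zero)
qed

end

section \<open>Leading terms for a non-archimedean absolute value\<close>

locale nonarch_abs =
  fixes abv :: "'k::field \<Rightarrow> real"
  assumes abv_zero [simp]: "abv 0 = 0"
    and abv_pos: "r \<noteq> 0 \<Longrightarrow> 0 < abv r"
    and abv_mult: "abv (r * s) = abv r * abv s"
    and abv_add: "abv (r + s) \<le> max (abv r) (abv s)"
begin

lemma abv_nonneg: "0 \<le> abv r"
  using abv_pos[of r] by (cases "r = 0") auto

lemma abv_one [simp]: "abv 1 = 1"
  using abv_mult[of 1 1] abv_pos[of 1] by simp

lemma abv_minus [simp]: "abv (- r) = abv r"
proof -
  have "abv (- 1) * abv (- 1) = 1" using abv_mult[of "- 1" "- 1"] by simp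
  hence "abv (- 1) = 1"
    using abv_nonneg[of "- 1"] by (metis abs_of_nonneg real_sqrt_abs2 real_sqrt_one)
  thus ?thesis using abv_mult[of "- 1" r] by simp
qed

lemma abv_inverse: "abv (inverse r) = inverse (abv r)"
proof (cases "r = 0")
  case False
  hence "abv r * abv (inverse r) = 1" using abv_mult[of r "inverse r"] by simp
  thus ?thesis by (metis inverse_unique)
qed simp

lemma abv_power: "abv (r ^ k) = abv r ^ k"
  by (induction k) (simp_all add: abv_mult)

lemma abv_powi: "abv (r powi k) = abv r powi k"
  by (simp add: power_int_def abv_power abv_inverse)

lemma abv_sum_less:
  assumes "finite A" "0 < r" "\<And>i. i \<in> A \<Longrightarrow> abv (f i) < r"
  shows "abv (\<Sum>i\<in>A. f i) < r"
  using assms(1,3)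
proof (induction A)
  case (insert a A)
  hence "max (abv (f a)) (abv (\<Sum>i\<in>A. f i)) < r" by auto
  thus ?case using insert.hyps le_less_trans[OF abv_add[of "f a" "\<Sum>i\<in>A. f i"]] by simp
qed (simp add: assms(2))

lemma abv_add_eq:
  assumes "abv s < abv r"
  shows "abv (r + s) = abv r"
  using abv_add[of r s] abv_add[of "r + s" "- s"] assms by (simp add: max_def split: if_splits)

text \<open>The vector \<open>v\<close> attains its size \<open>r\<close>, with respect to the weights \<open>\<omega>\<close>, exactly at the basis
  vectors of \<open>S\<close>. The case \<open>S = {}\<close> is not excluded; it says that \<open>v\<close> is smaller than \<open>r\<close>.\<close>

definition leading :: "('s \<Rightarrow> real) \<Rightarrow> ('s \<Rightarrow>\<^sub>0 'k) \<Rightarrow> 's set \<Rightarrow> real \<Rightarrow> bool" where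
  "leading \<omega> v S r \<longleftrightarrow> 0 < r \<and> (\<forall>s\<in>S. abv (Poly_Mapping.lookup v s) * \<omega> s = r) \<and>
     (\<forall>s. s \<notin> S \<longrightarrow> abv (Poly_Mapping.lookup v s) * \<omega> s < r)"

lemma leading_keys:
  assumes "leading \<omega> v S r"
  shows "S \<subseteq> Poly_Mapping.keys v"
proof
  fix s assume "s \<in> S"
  hence "abv (Poly_Mapping.lookup v s) * \<omega> s > 0" using assms by (simp add: leading_def)
  thus "s \<in> Poly_Mapping.keys v" by (cases "s \<in> Poly_Mapping.keys v") (auto simp: in_keys_iff)
qed

lemma leading_le: "leading \<omega> v S r \<Longrightarrow> abv (Poly_Mapping.lookup v s) * \<omega> s \<le> r"
  by (cases "s \<in> S") (auto simp: leading_def less_imp_le)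

lemma ex_leading:
  assumes "v \<noteq> 0" "\<And>s. 0 < \<omega> s"
  shows "\<exists>S r. S \<noteq> {} \<and> leading \<omega> v S r"
proof -
  let ?f = "\<lambda>s. abv (Poly_Mapping.lookup v s) * \<omega> s"
  let ?K = "Poly_Mapping.keys v"
  define r where "r = Max (?f ` ?K)"
  have K: "?K \<noteq> {}" "finite ?K" using assms(1) by auto
  have pos: "0 < ?f s" if "s \<in> ?K" for s
    using that abv_pos assms(2) by (auto simp: in_keys_iff)
  have le: "?f s \<le> r" if "s \<in> ?K" for s
    using that K by (simp add: r_def)
  have "r \<in> ?f ` ?K" unfolding r_def using K by (intro Max_in) auto
  then obtain s0 where s0: "s0 \<in> ?K" "?f s0 = r" by blast
  have r: "0 < r" using pos[OF s0(1)] s0(2) by simp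
  have "leading \<omega> v {s \<in> ?K. ?f s = r} r"
    unfolding leading_def
  proof (intro conjI allI impI ballI r)
    fix s assume "s \<notin> {s \<in> ?K. ?f s = r}"
    thus "?f s < r" using le[of s] r by (cases "s \<in> ?K") (auto simp: in_keys_iff)
  qed auto
  moreover have "{s \<in> ?K. ?f s = r} \<noteq> {}" using s0 by (auto intro: exI[of _ s0])
  ultimately show ?thesis by (intro exI conjI)
qed

text \<open>An operator that, up to terms of smaller size, scales sizes by \<open>\<beta>\<close> and moves basis
  vectors injectively along a partial map \<open>\<tau>\<close> with domain \<open>D\<close> acts on leading supports through
  \<open>\<tau>\<close>. Injectivity is what excludes cancellation: at \<open>\<tau> s\<close> only the coefficient of \<open>v\<close> at \<open>s\<close>
  contributes to full size, and the ultrametric inequality absorbs the rest.\<close>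

lemma leading_image:
  assumes v: "leading \<omega> v S r" "Poly_Mapping.keys v \<subseteq> B" and pos: "\<And>s. 0 < \<omega> s"
    and T: "plinear T" and \<beta>: "0 < \<beta>"
    and T_single: "\<And>s. s \<in> B \<Longrightarrow> \<exists>c R.
      T (Poly_Mapping.single s 1) = (if s \<in> D then Poly_Mapping.single (\<tau> s) c else 0) + R \<and>
      (s \<in> D \<longrightarrow> abv c * \<omega> (\<tau> s) = \<beta> * \<omega> s) \<and>
      (\<forall>t. abv (Poly_Mapping.lookup R t) * \<omega> t < \<beta> * \<omega> s)"
    and inj: "inj_on \<tau> (B \<inter> D)"
  shows "leading \<omega> (T v) (\<tau> ` (S \<inter> D)) (\<beta> * r)"
proof -
  let ?lv = "Poly_Mapping.lookup v"
  let ?K = "Poly_Mapping.keys v"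
  have r: "0 < r" using v(1) by (simp add: leading_def)
  from T_single obtain c R where
    T1: "\<And>s. s \<in> B \<Longrightarrow> T (Poly_Mapping.single s 1) =
        (if s \<in> D then Poly_Mapping.single (\<tau> s) (c s) else 0) + R s"
    and c: "\<And>s. s \<in> B \<Longrightarrow> s \<in> D \<Longrightarrow> abv (c s) * \<omega> (\<tau> s) = \<beta> * \<omega> s"
    and R: "\<And>s t. s \<in> B \<Longrightarrow> abv (Poly_Mapping.lookup (R s) t) * \<omega> t < \<beta> * \<omega> s"
    by metis
  define main where "main t s = (if s \<in> D \<and> \<tau> s = t then c s else 0)" for t s
  have lookup_T: "Poly_Mapping.lookup (T v) t =
     (\<Sum>s\<in>?K. ?lv s * main t s) + (\<Sum>s\<in>?K. ?lv s * Poly_Mapping.lookup (R s) t)" for t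
  proof -
    have "Poly_Mapping.lookup (T v) t =
        (\<Sum>s\<in>?K. ?lv s * Poly_Mapping.lookup (T (Poly_Mapping.single s 1)) t)"
      by (subst plinear_eq_lin_ext[OF T]) (simp add: lookup_lin_ext)
    also have "\<dots> = (\<Sum>s\<in>?K. ?lv s * main t s + ?lv s * Poly_Mapping.lookup (R s) t)"
    proof (rule sum.cong[OF refl])
      fix s assume "s \<in> ?K"
      hence "s \<in> B" using v(2) by blast
      thus "?lv s * Poly_Mapping.lookup (T (Poly_Mapping.single s 1)) t =
          ?lv s * main t s + ?lv s * Poly_Mapping.lookup (R s) t"
        by (auto simp: T1 main_def lookup_add lookup_single when_def algebra_simps)
    qed
    finally show ?thesis by (simp add: sum.distrib)
  qed
  have rest: "abv (\<Sum>s\<in>?K. ?lv s * Poly_Mapping.lookup (R s) t) < \<beta> * r / \<omega> t" for t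
  proof (rule abv_sum_less)
    show "0 < \<beta> * r / \<omega> t" using \<beta> r pos by simp
    fix s assume s: "s \<in> ?K"
    hence "abv (?lv s) * (abv (Poly_Mapping.lookup (R s) t) * \<omega> t) < abv (?lv s) * (\<beta> * \<omega> s)"
      using R[of s t] v(2) abv_pos[of "?lv s"]
      by (intro mult_strict_left_mono) (auto simp: in_keys_iff)
    also have "\<dots> = \<beta> * (abv (?lv s) * \<omega> s)" by simp
    also have "\<dots> \<le> \<beta> * r" using leading_le[OF v(1)] \<beta> by (intro mult_left_mono) auto
    finally show "abv (?lv s * Poly_Mapping.lookup (R s) t) < \<beta> * r / \<omega> t"
      using pos[of t] by (simp add: abv_mult pos_less_divide_eq mult.assoc)
  qed simp
  show ?thesis
    unfolding leading_def
  proof (intro conjI ballI allI impI)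
    show "0 < \<beta> * r" using \<beta> r by simp
  next
    fix t assume "t \<in> \<tau> ` (S \<inter> D)"
    then obtain s0 where s0: "s0 \<in> S" "s0 \<in> D" "t = \<tau> s0" by blast
    have s0K: "s0 \<in> ?K" using s0(1) leading_keys[OF v(1)] by blast
    have "main t s = (if s = s0 then c s0 else 0)" if "s \<in> ?K" for s
      using that s0 s0K v(2) inj by (auto simp: main_def dest: inj_onD)
    hence "(\<Sum>s\<in>?K. ?lv s * main t s) = (\<Sum>s\<in>?K. if s = s0 then ?lv s0 * c s0 else 0)"
      by (intro sum.cong) auto
    also have "\<dots> = ?lv s0 * c s0" using s0K by simp
    finally have m: "(\<Sum>s\<in>?K. ?lv s * main t s) = ?lv s0 * c s0" .
    have "s0 \<in> B" using s0K v(2) by blast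
    hence "abv (?lv s0 * c s0) * \<omega> t = abv (?lv s0) * \<omega> s0 * \<beta>"
      using c[of s0] s0 by (simp add: abv_mult mult.assoc mult.commute[of \<beta>])
    also have "\<dots> = \<beta> * r" using v(1) s0(1) by (simp add: leading_def)
    finally have a: "abv (?lv s0 * c s0) = \<beta> * r / \<omega> t"
      using pos[of t] by (simp add: field_simps)
    have "abv (Poly_Mapping.lookup (T v) t) = \<beta> * r / \<omega> t"
      unfolding lookup_T m using rest[of t] a by (simp add: abv_add_eq)
    thus "abv (Poly_Mapping.lookup (T v) t) * \<omega> t = \<beta> * r"
      using pos[of t] by simp
  next
    fix t assume t: "t \<notin> \<tau> ` (S \<inter> D)"
    have "abv (\<Sum>s\<in>?K. ?lv s * main t s) < \<beta> * r / \<omega> t"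
    proof (rule abv_sum_less)
      show p: "0 < \<beta> * r / \<omega> t" using \<beta> r pos by simp
      fix s assume s: "s \<in> ?K"
      show "abv (?lv s * main t s) < \<beta> * r / \<omega> t"
      proof (cases "s \<in> D \<and> \<tau> s = t")
        case True
        hence "s \<notin> S" using t by blast
        hence "abv (?lv s) * \<omega> s < r" using v(1) by (simp add: leading_def)
        moreover have "abv (c s) * \<omega> t = \<beta> * \<omega> s" using c[of s] s v(2) True by auto
        hence "abv (?lv s * c s) * \<omega> t = \<beta> * (abv (?lv s) * \<omega> s)"
          by (simp add: abv_mult mult.assoc mult.left_commute)
        ultimately show ?thesis
          using True \<beta> pos[of t] by (simp add: main_def pos_less_divide_eq)
      qed (use p in \<open>auto simp: main_def\<close>)
    qed simp
    hence "abv (Poly_Mapping.lookup (T v) t) < \<beta> * r / \<omega> t"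
      unfolding lookup_T using rest[of t] abv_add by (smt (verit))
    thus "abv (Poly_Mapping.lookup (T v) t) * \<omega> t < \<beta> * r"
      using pos[of t] by (simp add: pos_less_divide_eq)
  qed
qed

text \<open>Vectors dominated by distinct basis vectors are independent: in a linear combination,
  the summand of largest size cannot be cancelled at the basis vector that dominates it. If all of
  \<open>B\<close> occurs, there are as many of these vectors as the dimension.\<close>

lemma ex_single_leading_imp_all:
  assumes fin: "finite B" and pos: "\<And>s. 0 < \<omega> s"
    and U: "pm.subspace U" "\<And>v. v \<in> U \<Longrightarrow> Poly_Mapping.keys v \<subseteq> B"
    and lead: "\<And>t. t \<in> B \<Longrightarrow> \<exists>u\<in>U. \<exists>r. leading \<omega> u {t} r"
  shows "U = {v. Poly_Mapping.keys v \<subseteq> B}"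
proof
  show "U \<subseteq> {v. Poly_Mapping.keys v \<subseteq> B}" using U(2) by blast
next
  obtain u r where u: "\<And>t. t \<in> B \<Longrightarrow> u t \<in> U" "\<And>t. t \<in> B \<Longrightarrow> leading \<omega> (u t) {t} (r t)"
    using lead by metis
  have inj: "inj_on u B"
  proof (rule inj_onI, rule ccontr)
    fix s t assume st: "s \<in> B" "t \<in> B" "u s = u t" "s \<noteq> t"
    have "\<forall>x. x \<noteq> s \<longrightarrow> abv (Poly_Mapping.lookup (u t) x) * \<omega> x < r s"
      "\<forall>x. x \<noteq> t \<longrightarrow> abv (Poly_Mapping.lookup (u t) x) * \<omega> x < r t"
      "abv (Poly_Mapping.lookup (u t) s) * \<omega> s = r s"
      "abv (Poly_Mapping.lookup (u t) t) * \<omega> t = r t"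
      using u(2)[OF st(1)] u(2)[OF st(2)] unfolding st(3) leading_def by auto
    thus False using st(4) by (metis order_less_asym)
  qed
  have indep: "pm.independent (u ` B)"
  proof
    assume "pm.dependent (u ` B)"
    then obtain d where d: "\<exists>v\<in>u ` B. d v \<noteq> 0" "(\<Sum>v\<in>u ` B. pscale (d v) v) = 0"
      using pm.dependent_finite[of "u ` B"] fin by auto
    define e where "e t = d (u t)" for t
    let ?f = "\<lambda>t. abv (e t) * r t"
    have e: "\<exists>t\<in>B. e t \<noteq> 0" "(\<Sum>t\<in>B. pscale (e t) (u t)) = 0"
      using d inj by (auto simp: e_def sum.reindex)
    define m where "m = Max (?f ` B)"
    have le: "?f t \<le> m" if "t \<in> B" for t using that fin by (simp add: m_def)
    have rpos: "0 < r t" if "t \<in> B" for t using u(2)[OF that] by (simp add: leading_def)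
    obtain t1 where t1: "t1 \<in> B" "e t1 \<noteq> 0" using e(1) by blast
    have m: "0 < m"
      using le[OF t1(1)] abv_pos[OF t1(2)] rpos[OF t1(1)] by (smt (verit) mult_pos_pos)
    have "m \<in> ?f ` B" unfolding m_def using fin t1(1) by (intro Max_in) auto
    then obtain t0 where t0: "t0 \<in> B" "?f t0 = m" by blast
    let ?g = "\<lambda>t. e t * Poly_Mapping.lookup (u t) t0"
    have g0: "abv (?g t0) = m / \<omega> t0"
      using t0 u(2)[OF t0(1)] pos[of t0] by (auto simp: leading_def abv_mult field_simps)
    have "abv (\<Sum>t\<in>B - {t0}. ?g t) < m / \<omega> t0"
    proof (rule abv_sum_less)
      show p: "0 < m / \<omega> t0" using m pos by simp
      fix t assume t: "t \<in> B - {t0}"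
      show "abv (?g t) < m / \<omega> t0"
      proof (cases "e t = 0")
        case False
        have "abv (Poly_Mapping.lookup (u t) t0) * \<omega> t0 < r t"
          using u(2)[of t] t by (auto simp: leading_def)
        hence "abv (e t) * (abv (Poly_Mapping.lookup (u t) t0) * \<omega> t0) < ?f t"
          using abv_pos[OF False] by simp
        also have "\<dots> \<le> m" using le t by blast
        finally show ?thesis using pos[of t0] by (simp add: abv_mult pos_less_divide_eq mult.assoc)
      qed (use p in simp)
    qed (use fin in simp)
    hence "abv (?g t0 + (\<Sum>t\<in>B - {t0}. ?g t)) = m / \<omega> t0"
      using abv_add_eq[of "\<Sum>t\<in>B - {t0}. ?g t" "?g t0"] g0 by simp
    also have "?g t0 + (\<Sum>t\<in>B - {t0}. ?g t) = (\<Sum>t\<in>B. ?g t)"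
      using fin t0(1) by (simp add: sum.remove)
    also have "\<dots> = Poly_Mapping.lookup (\<Sum>t\<in>B. pscale (e t) (u t)) t0"
      by (simp add: lookup_sum)
    finally show False using e(2) m pos[of t0] by simp
  qed
  let ?b = "\<lambda>s. Poly_Mapping.single s (1 :: 'k)"
  have b_span: "v \<in> pm.span (?b ` B)" if "Poly_Mapping.keys v \<subseteq> B" for v
    using that pm.span_superset[of "?b ` B"]
    by (subst lin_ext_basis[symmetric], unfold lin_ext_def)
      (intro pm.span_sum pm.span_scale, blast)
  have "inj_on ?b B" by (rule inj_onI) (metis lookup_single_eq lookup_single_not_eq zero_neq_one)
  hence card: "card (?b ` B) = card (u ` B)" using inj by (simp add: card_image)
  \<comment> \<open>A vector outside the span of the independent family could be added to it, which exceeds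
    the dimension.\<close>
  have "pm.span (?b ` B) \<subseteq> pm.span (u ` B)"
  proof (rule ccontr)
    assume "\<not> ?thesis"
    then obtain v where v: "v \<in> pm.span (?b ` B)" "v \<notin> pm.span (u ` B)" by blast
    have "insert v (u ` B) \<subseteq> pm.span (?b ` B)" using b_span U(2) u(1) v(1) by blast
    hence "card (insert v (u ` B)) \<le> card (?b ` B)"
      using pm.independent_span_bound[OF _ pm.independent_insertI[OF v(2) indep]] fin by blast
    moreover have "v \<notin> u ` B" using v(2) pm.span_base by blast
    ultimately show False using card fin by simp
  qed
  also have "\<dots> \<subseteq> U" using pm.span_minimal[OF _ U(1), of "u ` B"] u(1) by blast
  finally have "pm.span (?b ` B) \<subseteq> U" .
  thus "{v. Poly_Mapping.keys v \<subseteq> B} \<subseteq> U" using b_span by blast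
qed

end

text \<open>A family of operators as in \<open>leading_image\<close>, acting on the span of a finite set \<open>B\<close> of
  basis vectors.\<close>

locale leading_moves = nonarch_abs abv
  for abv :: "'k::field \<Rightarrow> real" +
  fixes B :: "'s set" and \<omega> :: "'s \<Rightarrow> real" and G :: "'g set"
    and T :: "'g \<Rightarrow> ('s \<Rightarrow>\<^sub>0 'k) \<Rightarrow> ('s \<Rightarrow>\<^sub>0 'k)" and D :: "'g \<Rightarrow> 's set"
    and \<tau> :: "'g \<Rightarrow> 's \<Rightarrow> 's" and \<beta> :: "'g \<Rightarrow> real"
  assumes finite_B: "finite B" and \<omega>_pos: "0 < \<omega> s" and \<beta>_pos: "g \<in> G \<Longrightarrow> 0 < \<beta> g"
    and plinear_T: "g \<in> G \<Longrightarrow> plinear (T g)"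
    and T_single: "g \<in> G \<Longrightarrow> s \<in> B \<Longrightarrow> \<exists>c R.
      T g (Poly_Mapping.single s 1) = (if s \<in> D g then Poly_Mapping.single (\<tau> g s) c else 0) + R \<and>
      (s \<in> D g \<longrightarrow> abv c * \<omega> (\<tau> g s) = \<beta> g * \<omega> s) \<and>
      (\<forall>t. abv (Poly_Mapping.lookup R t) * \<omega> t < \<beta> g * \<omega> s)"
    and inj_\<tau>: "g \<in> G \<Longrightarrow> inj_on (\<tau> g) (B \<inter> D g)"
begin

text \<open>The potential \<open>P\<close> makes it possible to contract a leading support to \<open>s0\<close>: if it
  contains another element, a move defined there keeps it nonempty and lowers \<open>P\<close> on all of it. The
  potential \<open>Q\<close> measures how far a basis vector is from \<open>s0\<close> along the moves, which carries the
  single leading term from \<open>s0\<close> to every other basis vector.\<close>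

lemma invariant_subspace_eq_all:
  fixes P Q :: "'s \<Rightarrow> nat"
  assumes U: "pm.subspace U" "\<And>v. v \<in> U \<Longrightarrow> Poly_Mapping.keys v \<subseteq> B"
      "\<And>g v. g \<in> G \<Longrightarrow> v \<in> U \<Longrightarrow> T g v \<in> U" and "U \<noteq> {0}"
    and down: "\<And>s. s \<in> B \<Longrightarrow> s \<noteq> s0 \<Longrightarrow>
      \<exists>g\<in>G. s \<in> D g \<and> (\<forall>t\<in>B \<inter> D g. P (\<tau> g t) < P t)"
    and up: "\<And>t. t \<in> B \<Longrightarrow> t \<noteq> s0 \<Longrightarrow> \<exists>g\<in>G. \<exists>s\<in>B \<inter> D g. \<tau> g s = t \<and> Q s < Q t"
  shows "U = {v. Poly_Mapping.keys v \<subseteq> B}"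
proof -
  have step: "leading \<omega> (T g v) (\<tau> g ` (S \<inter> D g)) (\<beta> g * r)"
    if "g \<in> G" "v \<in> U" "leading \<omega> v S r" for g v S r
    using leading_image[OF that(3) U(2)[OF that(2)] \<omega>_pos plinear_T[OF that(1)]
        \<beta>_pos[OF that(1)] T_single[OF that(1)] inj_\<tau>[OF that(1)]] .
  have push: "\<exists>v\<in>U. \<exists>r. leading \<omega> v {s0} r"
    if "v \<in> U" "leading \<omega> v S r" "S \<noteq> {}" "\<forall>s\<in>S. P s \<le> k" for v S r k
    using that
  proof (induction k arbitrary: v S r rule: less_induct)
    case (less k)
    have SB: "S \<subseteq> B" using leading_keys[OF less.prems(2)] U(2)[OF less.prems(1)] by blast
    show ?case
    proof (cases "S = {s0}")
      case False
      then obtain s where s: "s \<in> S" "s \<noteq> s0" using less.prems(3) by blast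
      then obtain g where g: "g \<in> G" "s \<in> D g" "\<And>t. t \<in> B \<Longrightarrow> t \<in> D g \<Longrightarrow> P (\<tau> g t) < P t"
        using down[of s] SB by blast
      have lt: "P (\<tau> g t) < k" if "t \<in> S \<inter> D g" for t
        using g(3)[of t] less.prems(4) that SB by fastforce
      hence k: "0 < k" using s(1) g(2) by fastforce
      show ?thesis
      proof (rule less.IH)
        show "k - 1 < k" using k by simp
        show "T g v \<in> U" using U(3) g(1) less.prems(1) by blast
        show "leading \<omega> (T g v) (\<tau> g ` (S \<inter> D g)) (\<beta> g * r)"
          using step g(1) less.prems(1,2) by blast
        show "\<tau> g ` (S \<inter> D g) \<noteq> {}" using s(1) g(2) by blast
        show "\<forall>s\<in>\<tau> g ` (S \<inter> D g). P s \<le> k - 1" using lt by force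
      qed
    qed (use less.prems in blast)
  qed
  obtain v where "v \<in> U" "v \<noteq> 0" using assms(4) pm.subspace_0[OF U(1)] by blast
  moreover obtain S r where "S \<noteq> {}" "leading \<omega> v S r"
    using ex_leading[where \<omega> = \<omega>, OF \<open>v \<noteq> 0\<close>] \<omega>_pos by blast
  moreover have "\<forall>s\<in>S. P s \<le> Max (P ` Poly_Mapping.keys v)"
    using leading_keys[OF \<open>leading \<omega> v S r\<close>] by (auto intro!: Max_ge)
  ultimately have base: "\<exists>v\<in>U. \<exists>r. leading \<omega> v {s0} r" using push by blast
  have "\<exists>u\<in>U. \<exists>r. leading \<omega> u {t} r" if "t \<in> B" for t
    using that
  proof (induction "Q t" arbitrary: t rule: less_induct)
    case less
    show ?case
    proof (cases "t = s0")
      case False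
      then obtain g s where g: "g \<in> G" "s \<in> B" "s \<in> D g" "\<tau> g s = t" "Q s < Q t"
        using up[OF less.prems] by blast
      then obtain u r where u: "u \<in> U" "leading \<omega> u {s} r" using less.hyps by blast
      have "leading \<omega> (T g u) {t} (\<beta> g * r)"
        using step[OF g(1) u] g(3,4) by simp
      thus ?thesis using U(3) g(1) u(1) by blast
    qed (use base in simp)
  qed
  thus ?thesis using ex_single_leading_imp_all[where \<omega> = \<omega>, OF finite_B \<omega>_pos U(1,2)] by blast
qed

end

section \<open>The degree absolute value and quantum integers\<close>

text \<open>The degree of the numerator minus that of the denominator, which does not depend on the
  representation of the fraction.\<close>

definition fract_degree :: "'a::idom poly fract \<Rightarrow> int" where
  "fract_degree r = (THE d. \<exists>p q. p \<noteq> 0 \<and> q \<noteq> 0 \<and> r = Fract p q \<and> d = int (degree p) - int (degree q))"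

lemma fract_degree_Fract:
  assumes "p \<noteq> 0" "q \<noteq> 0"
  shows "fract_degree (Fract p q) = int (degree p) - int (degree q)"
  unfolding fract_degree_def
proof (rule the_equality)
  show "\<exists>p' q'. p' \<noteq> 0 \<and> q' \<noteq> 0 \<and> Fract p q = Fract p' q' \<and>
      int (degree p) - int (degree q) = int (degree p') - int (degree q')"
    using assms by blast
next
  fix d assume "\<exists>p' q'. p' \<noteq> 0 \<and> q' \<noteq> 0 \<and> Fract p q = Fract p' q' \<and>
      d = int (degree p') - int (degree q')"
  then obtain p' q' where *: "p' \<noteq> 0" "q' \<noteq> 0" "Fract p q = Fract p' q'"
      "d = int (degree p') - int (degree q')" by blast
  hence "p * q' = p' * q" using assms by (simp add: eq_fract)
  hence "degree p + degree q' = degree p' + degree q"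
    using assms * by (metis degree_mult_eq)
  thus "d = int (degree p) - int (degree q)" using *(4) by linarith
qed

definition degree_abs :: "real \<Rightarrow> 'a::idom poly fract \<Rightarrow> real" where
  "degree_abs b r = (if r = 0 then 0 else b powi fract_degree r)"

lemma degree_abs_Fract:
  "p \<noteq> 0 \<Longrightarrow> q \<noteq> 0 \<Longrightarrow> degree_abs b (Fract p q) = b powi (int (degree p) - int (degree q))"
  by (simp add: degree_abs_def fract_degree_Fract Zero_fract_def eq_fract)

lemma degree_abs_const: "c \<noteq> 0 \<Longrightarrow> degree_abs b (Fract [:c:] 1) = 1"
  by (simp add: degree_abs_Fract)

lemma nonarch_abs_degree_abs:
  assumes b: "1 < b"
  shows "nonarch_abs (degree_abs b :: 'a::idom poly fract \<Rightarrow> real)"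
proof
  fix r s :: "'a poly fract"
  show "degree_abs b (0 :: 'a poly fract) = 0" by (simp add: degree_abs_def)
  show "0 < degree_abs b r" if "r \<noteq> 0"
    using that b by (simp add: degree_abs_def)
  obtain p q where r: "r = Fract p q" "q \<noteq> 0" by (cases r) auto
  obtain p' q' where s: "s = Fract p' q'" "q' \<noteq> 0" by (cases s) auto
  have zero: "Fract u v = 0 \<longleftrightarrow> u = 0" if "v \<noteq> 0" for u v :: "'a poly"
    using that by (simp add: Zero_fract_def eq_fract)
  show "degree_abs b (r * s) = degree_abs b r * degree_abs b s"
  proof (cases "p = 0 \<or> p' = 0")
    case False
    hence "int (degree (p * p')) - int (degree (q * q')) =
        (int (degree p) - int (degree q)) + (int (degree p') - int (degree q'))"
      using r s by (simp add: degree_mult_eq)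
    thus ?thesis using False r s b by (simp add: degree_abs_Fract power_int_add)
  qed (use r s in \<open>auto simp: degree_abs_def zero\<close>)
  show "degree_abs b (r + s) \<le> max (degree_abs b r) (degree_abs b s)"
  proof (cases "p = 0 \<or> p' = 0 \<or> r + s = 0")
    case True
    consider "r = 0" | "s = 0" | "r + s = 0" using True r s zero by blast
    thus ?thesis
      using b by cases (auto simp: degree_abs_def le_max_iff_disj)
  next
    case False
    let ?u = "p * q' + p' * q"
    have rs: "r + s = Fract ?u (q * q')" using r s by simp
    have u: "?u \<noteq> 0" using False rs r s zero[of "q * q'" ?u] by auto
    have "degree ?u \<le> max (degree (p * q')) (degree (p' * q))"
      by (rule degree_add_le_max)
    hence "degree ?u \<le> max (degree p + degree q') (degree p' + degree q)"
      using False r s by (simp add: degree_mult_eq)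
    hence "int (degree ?u) - int (degree (q * q')) \<le> int (degree p) - int (degree q) \<or>
        int (degree ?u) - int (degree (q * q')) \<le> int (degree p') - int (degree q')"
      using r(2) s(2) by (auto simp: degree_mult_eq le_max_iff_disj)
    hence "b powi (int (degree ?u) - int (degree (q * q'))) \<le> b powi (int (degree p) - int (degree q)) \<or>
        b powi (int (degree ?u) - int (degree (q * q'))) \<le> b powi (int (degree p') - int (degree q'))"
      using b by (auto intro!: power_int_increasing)
    thus ?thesis
      unfolding rs unfolding r(1) s(1) using False r(2) s(2) u
      by (simp add: degree_abs_Fract le_max_iff_disj)
  qed
qed

lemma q_par_power: "q_par ^ k = Fract [:[:monom 1 (2 * k):]:] 1"
proof -
  have "q_half ^ j = Fract [:[:monom 1 j:]:] 1" for j
  proof (induction j)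
    case 0
    show ?case by (simp add: One_fract_def monom_0 one_pCons)
  next
    case (Suc j)
    have "[:[:[:0, 1:]:]:] * [:[:monom 1 j:]:] = [:[:monom (1::complex) (Suc j):]:]"
      by (simp add: monom_Suc)
    thus ?case
      unfolding power_Suc Suc.IH unfolding q_half_def mult_fract by (simp only: mult_1)
  qed
  thus ?thesis unfolding q_par_def power_mult[symmetric] .
qed

text \<open>Differences \<open>q\<^sup>k - 1\<close> are constant in the outermost variable \<open>y\<close>, so their absolute value
  is 1 as soon as they do not vanish. That \<open>q\<close> is not a root of unity and that \<open>|[k]| = 1\<close> for \<open>k > 0\<close>
  come from this.\<close>

lemma degree_abs_q_par_power_minus_one:
  assumes "0 < k"
  shows "degree_abs b (q_par ^ k - 1) = 1"
proof -
  have "q_par ^ k - 1 = Fract [:[:monom 1 (2 * k) - 1:]:] 1"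
    by (simp add: q_par_power One_fract_def one_pCons)
  moreover have "coeff (monom (1 :: complex) (2 * k) - 1) (2 * k) = 1"
    using assms by simp
  hence "monom (1 :: complex) (2 * k) - 1 \<noteq> 0" by force
  ultimately show ?thesis by (simp add: degree_abs_const)
qed

lemma degree_abs_q_par: "degree_abs b q_par = 1"
proof -
  have *: "q_par = Fract [:[:monom 1 2:]:] 1" using q_par_power[of 1] by simp
  show ?thesis unfolding * by (rule degree_abs_const) (simp add: monom_eq_0_iff)
qed

lemma q_par_nonzero: "q_par \<noteq> 0"
  using degree_abs_q_par[of 1] by (auto simp: degree_abs_def)

lemma q_par_power_neq_one: "0 < k \<Longrightarrow> q_par ^ k \<noteq> 1"
  using degree_abs_q_par_power_minus_one[of k 1] by (auto simp: degree_abs_def)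

lemma q_par_denominator: "q_par - inverse q_par \<noteq> 0"
  using q_par_power_neq_one[of 2] q_par_nonzero by (simp add: power2_eq_square field_simps)

lemma degree_abs_x_par: "degree_abs b x_par = 1"
  unfolding x_par_def by (rule degree_abs_const) simp

lemma degree_abs_y_par: "degree_abs b y_par = b"
  unfolding y_par_def by (simp add: degree_abs_Fract)

lemma x_par_nonzero: "x_par \<noteq> 0" and y_par_nonzero: "y_par \<noteq> 0"
  by (simp_all add: x_par_def y_par_def Zero_fract_def eq_fract)

lemma qint_0 [simp]: "qint 0 = 0"
  by (simp add: qint_def)

lemma qint_1 [simp]: "qint 1 = 1"
  using q_par_denominator by (simp add: qint_def power_int_minus)

lemma degree_abs_qint:
  assumes "1 < b" "0 < k"
  shows "degree_abs b (qint k) = 1"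
proof -
  interpret nonarch_abs "degree_abs b :: ground \<Rightarrow> real" by (rule nonarch_abs_degree_abs) fact
  obtain j where j: "k = int j" "0 < j" using assms(2) by (metis zero_less_imp_eq_int)
  have *: "q_par ^ i - inverse (q_par ^ i) = (q_par ^ (2 * i) - 1) * inverse (q_par ^ i)" for i
    using q_par_nonzero by (simp add: field_simps power_add[symmetric] mult_2_right)
  have "qint k = (q_par ^ (2 * j) - 1) * inverse (q_par ^ j) /
      ((q_par ^ (2 * 1) - 1) * inverse (q_par ^ 1))"
    unfolding *[symmetric] by (simp add: qint_def j power_int_minus)
  thus ?thesis
    using j(2) by (simp only: divide_inverse abv_mult abv_inverse abv_power
        degree_abs_q_par_power_minus_one degree_abs_q_par) simp
qed

section \<open>Tensor products of modules\<close>

text \<open>The defining relations, imposed on a subspace \<open>W\<close> only: for the representations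
  \<open>\<pi>\<^sub>z\<close> they fail on the basis vectors whose index is not a valid multi-index.\<close>

locale UA_word_action = word_action \<rho> for \<rho> +
  fixes n :: nat and \<epsilon> :: "nat \<Rightarrow> nat" and W :: "('b \<Rightarrow>\<^sub>0 ground) set"
  assumes preserve: "g \<in> generators n \<Longrightarrow> v \<in> W \<Longrightarrow> \<rho> (gen g) v \<in> W"
    and K_Kinv: "i < n \<Longrightarrow> v \<in> W \<Longrightarrow> \<rho> (gen (K i)) (\<rho> (gen (Kinv i)) v) = v"
    and Kinv_K: "i < n \<Longrightarrow> v \<in> W \<Longrightarrow> \<rho> (gen (Kinv i)) (\<rho> (gen (K i)) v) = v"
    and K_K: "i < n \<Longrightarrow> j < n \<Longrightarrow> v \<in> W \<Longrightarrow>
      \<rho> (gen (K i)) (\<rho> (gen (K j)) v) = \<rho> (gen (K j)) (\<rho> (gen (K i)) v)"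
    and K_E: "i < n \<Longrightarrow> j < n \<Longrightarrow> v \<in> W \<Longrightarrow>
      \<rho> (gen (K i)) (\<rho> (gen (E j)) v) =
        pscale (D_coeff n \<epsilon> i j) (\<rho> (gen (E j)) (\<rho> (gen (K i)) v))"
    and K_F: "i < n \<Longrightarrow> j < n \<Longrightarrow> v \<in> W \<Longrightarrow>
      \<rho> (gen (K i)) (\<rho> (gen (F j)) v) =
        pscale (inverse (D_coeff n \<epsilon> i j)) (\<rho> (gen (F j)) (\<rho> (gen (K i)) v))"
    and E_F: "i < n \<Longrightarrow> j < n \<Longrightarrow> v \<in> W \<Longrightarrow>
      \<rho> (gen (E i)) (\<rho> (gen (F j)) v) = \<rho> (gen (F j)) (\<rho> (gen (E i)) v) +
        (if i = j then pscale (1 / (q_par - inverse q_par)) (\<rho> (gen (K i)) v - \<rho> (gen (Kinv i)) v)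
         else 0)"
begin

lemma plinear_gen: "plinear (\<rho> (gen g))"
  unfolding gen_def by (rule plinear_word)

lemma gen_preserve:
  assumes "i < n" "v \<in> W"
  shows "\<rho> (gen (E i)) v \<in> W" "\<rho> (gen (F i)) v \<in> W" "\<rho> (gen (K i)) v \<in> W"
    "\<rho> (gen (Kinv i)) v \<in> W"
  using assms by (auto intro!: preserve simp: generators_def)

text \<open>Commuting \<open>k\<^sub>i\<^sup>-\<^sup>1\<close> past \<open>e\<^sub>j\<close> is not among the defining relations; conjugating
  \<open>k\<^sub>i e\<^sub>j = D\<^sub>i\<^sub>,\<^sub>j e\<^sub>j k\<^sub>i\<close> by \<open>k\<^sub>i\<close> supplies it for the mixed terms of \<open>[\<Delta> e\<^sub>i, \<Delta> f\<^sub>j]\<close>.\<close>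

lemma E_Kinv:
  assumes "i < n" "j < n" "v \<in> W"
  shows "\<rho> (gen (E j)) (\<rho> (gen (Kinv i)) v) =
    pscale (D_coeff n \<epsilon> i j) (\<rho> (gen (Kinv i)) (\<rho> (gen (E j)) v))"
proof -
  let ?u = "\<rho> (gen (Kinv i)) v"
  have u: "?u \<in> W" using assms gen_preserve by blast
  have "\<rho> (gen (E j)) ?u = \<rho> (gen (Kinv i)) (\<rho> (gen (K i)) (\<rho> (gen (E j)) ?u))"
    using assms u by (simp add: Kinv_K gen_preserve)
  also have "\<dots> = pscale (D_coeff n \<epsilon> i j) (\<rho> (gen (Kinv i)) (\<rho> (gen (E j)) v))"
    using assms u by (simp add: K_E plinearD[OF plinear_gen] K_Kinv)
  finally show ?thesis .
qed

end

lemma free_algebra_gen: "g \<in> generators n \<Longrightarrow> gen g \<in> free_algebra n"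
  by (simp add: free_algebra_def gen_def)

lemma tensor_space_memI: "v \<in> W \<Longrightarrow> w \<in> W' \<Longrightarrow> tensor v w \<in> tensor_space W W'"
  unfolding tensor_space_def by (rule pm.span_base) blast

lemma subspace_tensor_space: "pm.subspace (tensor_space W W')"
  unfolding tensor_space_def by (rule pm.subspace_span)

lemma D_coeff_commute: "D_coeff n \<epsilon> i j = D_coeff n \<epsilon> j i"
  unfolding D_coeff_def by (simp add: Int_commute eq_commute)

lemma D_coeff_nonzero: "D_coeff n \<epsilon> i j \<noteq> 0"
  by (auto simp: D_coeff_def q_idx_def q_par_nonzero)

locale UA_word_action_pair =
  A: UA_word_action \<rho> n \<epsilon> W + B: UA_word_action \<sigma> n \<epsilon> W' for \<rho> \<sigma> n \<epsilon> W W'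
begin

sublocale word_action_pair \<rho> \<sigma> ..

abbreviation act :: "free_elt \<Rightarrow> ('a \<times> 'b \<Rightarrow>\<^sub>0 ground) \<Rightarrow> ('a \<times> 'b \<Rightarrow>\<^sub>0 ground)" where
  "act \<equiv> tensor_action \<rho> \<sigma>"

lemma act_gen_preserve:
  assumes g: "g \<in> generators n" and p: "p \<in> tensor_space W W'"
  shows "act (gen g) p \<in> tensor_space W W'"
  using plinear_tensor_action subspace_tensor_space _ p[unfolded tensor_space_def]
proof (rule plinear_span_subset)
  fix t assume "t \<in> {tensor v w |v w. v \<in> W \<and> w \<in> W'}"
  then obtain v w where "t = tensor v w" "v \<in> W" "w \<in> W'" by blast
  thus "act (gen g) t \<in> tensor_space W W'"
    using g by (auto simp: generators_def tensor_action_gen intro!: tensor_space_memI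
        pm.subspace_add[OF subspace_tensor_space] A.gen_preserve B.gen_preserve)
qed

lemma act_preserve:
  assumes a: "a \<in> free_algebra n" and p: "p \<in> tensor_space W W'"
  shows "act a p \<in> tensor_space W W'"
proof -
  have word: "act (Poly_Mapping.single (Word gs) 1) p \<in> tensor_space W W'"
    if "set gs \<subseteq> generators n" for gs
    using that
  proof (induction gs)
    case Nil
    thus ?case using p tensor_action_one[of p] by (simp add: zero_word_def[symmetric])
  next
    case (Cons g gs)
    have "Poly_Mapping.single (Word (g # gs)) 1 = gen g * Poly_Mapping.single (Word gs) 1"
      by (simp add: gen_def mult_single plus_word_def)
    thus ?case using Cons act_gen_preserve by (simp add: tensor_action_mult)
  qed
  have "act a p = lin_ext (\<lambda>w. act (Poly_Mapping.single w 1) p) a"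
    by (rule plinear_eq_lin_ext[OF plinear_tensor_action_left])
  also have "\<dots> \<in> tensor_space W W'"
    unfolding lin_ext_def
  proof (intro pm.subspace_sum pm.subspace_scale subspace_tensor_space)
    fix w assume "w \<in> Poly_Mapping.keys a"
    hence "set (letters w) \<subseteq> generators n" using a by (simp add: free_algebra_def)
    thus "act (Poly_Mapping.single w 1) p \<in> tensor_space W W'"
      using word[of "letters w"] by simp
  qed
  finally show ?thesis .
qed

lemma act_diff: "act (a - b) p = act a p - act b p"
  and act_pscale: "act (pscale c a) p = pscale c (act a p)"
  and act_zero: "act 0 p = 0"
  and act_add: "act (a + b) p = act a p + act b p"
  using plinearD[OF plinear_tensor_action_left] by auto

lemma tensor_relation_K_Kinv:
  assumes "i < n" "v \<in> W" "w \<in> W'"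
  shows "act (gen (K i)) (act (gen (Kinv i)) (tensor v w)) = tensor v w"
    "act (gen (Kinv i)) (act (gen (K i)) (tensor v w)) = tensor v w"
  using assms by (simp_all add: tensor_action_gen A.K_Kinv B.K_Kinv A.Kinv_K B.Kinv_K)

lemma tensor_relation_K_K:
  assumes "i < n" "j < n" "v \<in> W" "w \<in> W'"
  shows "act (gen (K i)) (act (gen (K j)) (tensor v w)) =
    act (gen (K j)) (act (gen (K i)) (tensor v w))"
  using assms by (simp add: tensor_action_gen A.K_K[of i j] B.K_K[of i j])

lemma tensor_relation_K_E:
  assumes "i < n" "j < n" "v \<in> W" "w \<in> W'"
  shows "act (gen (K i)) (act (gen (E j)) (tensor v w)) =
    pscale (D_coeff n \<epsilon> i j) (act (gen (E j)) (act (gen (K i)) (tensor v w)))"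
  using assms
  by (simp add: tensor_action_gen plinearD[OF plinear_tensor_action] A.K_E B.K_E
      B.K_K[of i j] tensor_bilinear pm.scale_right_distrib)

lemma tensor_relation_K_F:
  assumes "i < n" "j < n" "v \<in> W" "w \<in> W'"
  shows "act (gen (K i)) (act (gen (F j)) (tensor v w)) =
    pscale (inverse (D_coeff n \<epsilon> i j)) (act (gen (F j)) (act (gen (K i)) (tensor v w)))"
proof -
  have "\<rho> (gen (K i)) (\<rho> (gen (Kinv j)) v) =
      \<rho> (gen (Kinv j)) (\<rho> (gen (K j)) (\<rho> (gen (K i)) (\<rho> (gen (Kinv j)) v)))"
    using assms by (simp add: A.Kinv_K A.gen_preserve)
  also have "\<dots> = \<rho> (gen (Kinv j)) (\<rho> (gen (K i)) v)"
    using assms by (simp add: A.K_K[of j i] A.K_Kinv A.gen_preserve)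
  finally show ?thesis
    using assms
    by (simp add: tensor_action_gen plinearD[OF plinear_tensor_action] A.K_F B.K_F
        tensor_bilinear pm.scale_right_distrib)
qed

text \<open>In \<open>[\<Delta> e\<^sub>i, \<Delta> f\<^sub>j]\<close> the mixed terms \<open>e\<^sub>i k\<^sub>j\<^sup>-\<^sup>1 \<otimes> k\<^sub>i f\<^sub>j\<close> and
  \<open>k\<^sub>j\<^sup>-\<^sup>1 e\<^sub>i \<otimes> f\<^sub>j k\<^sub>i\<close> agree, because \<open>D\<close> is symmetric. What remains is
  \<open>k\<^sub>j\<^sup>-\<^sup>1 \<otimes> [e\<^sub>i, f\<^sub>j] + [e\<^sub>i, f\<^sub>j] \<otimes> k\<^sub>i\<close>, which telescopes to the commutator of the tensor
  product.\<close>

lemma tensor_relation_E_F: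
  assumes "i < n" "j < n" "v \<in> W" "w \<in> W'"
  shows "act (gen (E i)) (act (gen (F j)) (tensor v w)) =
    act (gen (F j)) (act (gen (E i)) (tensor v w)) +
    (if i = j then pscale (1 / (q_par - inverse q_par))
       (act (gen (K i)) (tensor v w) - act (gen (Kinv i)) (tensor v w)) else 0)"
proof -
  let ?D = "D_coeff n \<epsilon> i j"
  have D: "?D \<noteq> 0" by (rule D_coeff_nonzero)
  \<comment> \<open>The scalars \<open>D\<close> from the first factor and \<open>D\<^sup>-\<^sup>1\<close> from the second cancel.\<close>
  have cross: "tensor (\<rho> (gen (E i)) (\<rho> (gen (Kinv j)) v)) (\<sigma> (gen (K i)) (\<sigma> (gen (F j)) w)) =
      tensor (\<rho> (gen (Kinv j)) (\<rho> (gen (E i)) v)) (\<sigma> (gen (F j)) (\<sigma> (gen (K i)) w))"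
    using assms D by (simp add: A.E_Kinv B.K_F tensor_bilinear D_coeff_commute[of n \<epsilon> j i])
  show ?thesis
    using assms cross
    by (simp add: tensor_action_gen plinearD[OF plinear_tensor_action] A.E_F B.E_F A.gen_preserve
        B.gen_preserve tensor_bilinear plinearD[OF A.plinear_gen] plinearD[OF B.plinear_gen]
        pm.scale_right_diff_distrib algebra_simps)
qed

lemma act_relation:
  assumes r: "r \<in> UA_relations n \<epsilon>" and p: "p \<in> tensor_space W W'"
  shows "act r p = 0"
proof (rule plinear_eq_on_span[OF plinear_tensor_action _ _ p[unfolded tensor_space_def]])
  show "plinear (\<lambda>_. 0 :: 'a \<times> 'b \<Rightarrow>\<^sub>0 ground)" by (rule plinearI) simp_all
  fix t assume "t \<in> {tensor v w |v w. v \<in> W \<and> w \<in> W'}"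
  then obtain v w where t: "t = tensor v w" "v \<in> W" "w \<in> W'" by blast
  show "act r t = 0"
    using r unfolding UA_relations_def t(1)
    by (elim UnE UN_E insertE emptyE)
      (simp_all add: act_diff act_pscale act_zero tensor_action_mult tensor_action_one t(2,3)
        tensor_relation_K_Kinv tensor_relation_K_K tensor_relation_K_E tensor_relation_K_F
        tensor_relation_E_F)
qed

text \<open>An element \<open>r a\<close> of the ideal kills the module only because \<open>a\<close> maps the module to itself,
  the relations not being valid on the whole ambient space.\<close>

lemma act_ideal:
  assumes a: "a \<in> UA_ideal n \<epsilon>" and p: "p \<in> tensor_space W W'"
  shows "act a p = 0"
  using a[unfolded UA_ideal_def] p
proof (induction arbitrary: p)
  case (base r)
  thus ?case using act_relation by blast
next
  case (right a r)
  thus ?case using act_preserve by (simp add: tensor_action_mult)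
qed (simp_all add: act_zero act_add tensor_action_mult plinearD[OF plinear_tensor_action])

theorem UA_module_tensor: "UA_module n \<epsilon> act (tensor_space W W')"
  unfolding UA_module_def
  by (simp add: subspace_tensor_space act_preserve act_add act_pscale act_ideal tensor_action_one
      tensor_action_mult plinearD[OF plinear_tensor_action])

end

section \<open>The relations in the representation\<close>

definition move :: "nat \<Rightarrow> nat \<Rightarrow> multi_index \<Rightarrow> multi_index" where
  "move s t m = (\<lambda>j. m j - unit_vec s j + unit_vec t j)"

lemma move_apply:
  "s \<noteq> t \<Longrightarrow> move s t m j = (if j = s then m j - 1 else if j = t then m j + 1 else m j)"
  by (simp add: move_def unit_vec_def)

lemma move_commute: "move s t (move u w m) = move u w (move s t m)"
  by (simp add: move_def fun_eq_iff)

lemma move_move_back [simp]: "move s t (move t s m) = m"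
  by (simp add: move_def fun_eq_iff)

text \<open>A particle can leave an occupied site only, and can enter a fermionic site only if that
  site is empty.\<close>

lemma valid_index_move:
  assumes "valid_index n \<kappa> m" "s \<in> {1..n}" "t \<in> {1..n}" "s \<noteq> t"
  shows "valid_index n \<kappa> (move s t m) \<longleftrightarrow> 1 \<le> m s \<and> (t \<le> \<kappa> \<longrightarrow> m t = 0)"
proof
  assume "valid_index n \<kappa> (move s t m)"
  hence "0 \<le> move s t m s" "t \<le> \<kappa> \<longrightarrow> move s t m t \<le> 1"
    using assms by (auto simp: valid_index_def)
  moreover have "0 \<le> m t" using assms by (auto simp: valid_index_def)
  ultimately show "1 \<le> m s \<and> (t \<le> \<kappa> \<longrightarrow> m t = 0)" using assms(4) by (auto simp: move_apply)
next
  assume *: "1 \<le> m s \<and> (t \<le> \<kappa> \<longrightarrow> m t = 0)"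
  show "valid_index n \<kappa> (move s t m)"
    unfolding valid_index_def move_apply[OF assms(4)]
  proof (intro conjI allI impI ballI)
    fix i assume i: "i \<in> {1..\<kappa>}"
    hence "m i \<le> 1" using assms(1) by (simp add: valid_index_def)
    thus "(if i = s then m i - 1 else if i = t then m i + 1 else m i) \<le> 1"
      using i * by auto
  qed (use * assms in \<open>auto simp: valid_index_def\<close>)
qed

definition basis :: "nat \<Rightarrow> nat \<Rightarrow> nat \<Rightarrow> multi_index set" where
  "basis n \<kappa> l = {m. valid_index n \<kappa> m \<and> (\<Sum>i=1..n. m i) = int l}"

lemma W_space_eq_span: "W_space n \<kappa> l = pm.span (ket n \<kappa> ` basis n \<kappa> l)"
  unfolding W_space_def basis_def by (rule arg_cong[where f = pm.span]) blast

lemma sum_move: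
  assumes "s \<in> {1..n}" "t \<in> {1..n}" 
  shows "(\<Sum>i=1..n. f i * move s t m i) = (\<Sum>i=1..n. f i * m i) - f s + f t"
  using assms by (simp add: move_def unit_vec_def algebra_simps sum.distrib sum_subtractf sum.delta
      if_distrib[of "(*) _"] cong: if_cong)

lemma move_in_basis:
  assumes "m \<in> basis n \<kappa> l" "s \<in> {1..n}" "t \<in> {1..n}" "valid_index n \<kappa> (move s t m)"
  shows "move s t m \<in> basis n \<kappa> l"
  using assms sum_move[OF assms(2,3), of "\<lambda>_. 1" m] by (simp add: basis_def)

text \<open>The common shape of \<open>e\<^sub>i\<close> and \<open>f\<^sub>i\<close>: a particle moves from site \<open>s\<close> to site \<open>t\<close>, with the
  quantum integer of the occupation of \<open>s\<close> as coefficient.\<close>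

definition hop :: "nat \<Rightarrow> nat \<Rightarrow> nat \<Rightarrow> nat \<Rightarrow> (multi_index \<Rightarrow>\<^sub>0 ground) \<Rightarrow> (multi_index \<Rightarrow>\<^sub>0 ground)" where
  "hop n \<kappa> s t = lin_ext (\<lambda>m. pscale (qint (m s)) (ket n \<kappa> (move s t m)))"

lemma plinear_hop: "plinear (hop n \<kappa> s t)"
  unfolding hop_def by (rule plinear_lin_ext)

lemma hop_ket:
  "valid_index n \<kappa> m \<Longrightarrow> hop n \<kappa> s t (ket n \<kappa> m) = pscale (qint (m s)) (ket n \<kappa> (move s t m))"
  by (simp add: hop_def ket_def)

definition site_q :: "nat \<Rightarrow> nat \<Rightarrow> ground" where
  "site_q \<kappa> s = (if s \<le> \<kappa> then - inverse q_par else q_par)"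

text \<open>The eigenvalue of \<open>k\<^sub>i\<close> for \<open>s = i\<close> and \<open>t = i + 1\<close>.\<close>

definition hop_weight :: "nat \<Rightarrow> nat \<Rightarrow> nat \<Rightarrow> multi_index \<Rightarrow> ground" where
  "hop_weight \<kappa> s t m = site_q \<kappa> s powi (- m s) * site_q \<kappa> t powi m t"

lemma site_q_nonzero: "site_q \<kappa> s \<noteq> 0"
  by (simp add: site_q_def q_par_nonzero)

lemma q_idx_ones_zeros: "q_idx n (ones_zeros \<kappa>) i = site_q \<kappa> (pos n i)"
  by (simp add: q_idx_def ones_zeros_def site_q_def)

lemma hop_weight_nonzero: "hop_weight \<kappa> s t m \<noteq> 0"
  by (simp add: hop_weight_def site_q_nonzero)

lemma hop_weight_move:
  assumes "a \<noteq> b"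
  shows "hop_weight \<kappa> s t (move a b m) = site_q \<kappa> s powi (of_bool (s = a) - of_bool (s = b)) *
    site_q \<kappa> t powi (of_bool (t = b) - of_bool (t = a)) * hop_weight \<kappa> s t m"
  using assms site_q_nonzero
  by (auto simp: hop_weight_def move_apply power_int_diff power_int_add power_int_minus field_simps)

text \<open>The formula remains true if the intermediate index is not valid. Then either site \<open>u\<close> is
  empty and the coefficient vanishes, or the fermionic site \<open>w\<close> is already occupied, and, no
  particle leaving \<open>w\<close> in the second hop, the final index is not valid either.\<close>

lemma hop_hop:
  assumes m: "valid_index n \<kappa> m" and st: "{s, t, u, w} \<subseteq> {1..n}" "s \<noteq> t" "u \<noteq> w" "s \<noteq> w"
  shows "hop n \<kappa> s t (hop n \<kappa> u w (ket n \<kappa> m)) =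
    pscale (qint (m u) * qint (m s - of_bool (s = u))) (ket n \<kappa> (move s t (move u w m)))"
proof (cases "valid_index n \<kappa> (move u w m)")
  case True
  thus ?thesis
    using st by (simp add: hop_ket m plinearD[OF plinear_hop] move_apply)
next
  case False
  have pos: "0 \<le> m u" "0 \<le> m w" using m st by (auto simp: valid_index_def)
  hence "m u = 0 \<or> w \<le> \<kappa> \<and> 0 < m w"
    using False valid_index_move[OF m, of u w] st by auto
  moreover have "\<not> valid_index n \<kappa> (move s t (move u w m))" if "w \<le> \<kappa>" "0 < m w"
  proof
    assume "valid_index n \<kappa> (move s t (move u w m))"
    hence "move s t (move u w m) w \<le> 1" using that st by (auto simp: valid_index_def)
    thus False using that st by (auto simp: move_apply split: if_splits)
  qed
  ultimately have "qint (m u) = 0 \<or> ket n \<kappa> (move s t (move u w m)) = 0"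
    by (auto simp: ket_def)
  moreover have "hop n \<kappa> s t (hop n \<kappa> u w (ket n \<kappa> m)) = 0"
    using False by (simp add: hop_ket m ket_def[of _ _ "move u w m"] plinearD[OF plinear_hop])
  ultimately show ?thesis by auto
qed

text \<open>For \<open>s = u\<close> both sides carry \<open>[m\<^sub>s] [m\<^sub>s - 1]\<close>; otherwise the two hops do not change each
  other's coefficient. This gives \<open>[e\<^sub>i, f\<^sub>j] = 0\<close> for \<open>i \<noteq> j\<close>, also for \<open>n = 2\<close>, where
  \<open>e\<^sub>i\<close> and \<open>f\<^sub>j\<close> are the same hop up to a scalar.\<close>

lemma hop_commute:
  assumes "valid_index n \<kappa> m" "{s, t, u, w} \<subseteq> {1..n}" "s \<noteq> t" "u \<noteq> w" "s \<noteq> w" "t \<noteq> u"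
  shows "hop n \<kappa> s t (hop n \<kappa> u w (ket n \<kappa> m)) = hop n \<kappa> u w (hop n \<kappa> s t (ket n \<kappa> m))"
proof -
  have "hop n \<kappa> u w (hop n \<kappa> s t (ket n \<kappa> m)) =
      pscale (qint (m s) * qint (m u - of_bool (u = s))) (ket n \<kappa> (move u w (move s t m)))"
    using assms by (intro hop_hop) auto
  moreover have "qint (m s) * qint (m u - of_bool (u = s)) = qint (m u) * qint (m s - of_bool (s = u))"
    by (auto simp: mult.commute)
  ultimately show ?thesis
    using hop_hop[OF assms(1-5)] by (simp add: move_commute[of s])
qed

lemma qint_eq: "qint k = (q_par powi k - inverse (q_par powi k)) / (q_par - inverse q_par)"
  by (simp add: qint_def power_int_minus)

lemma qint_commutator:
  "qint b * qint (a + 1) - qint a * qint (b + 1) =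
    (q_par powi (- a) * q_par powi b - q_par powi a * q_par powi (- b)) / (q_par - inverse q_par)"
proof -
  let ?q = "q_par" and ?d = "q_par - inverse q_par"
  let ?A = "q_par powi a" and ?B = "q_par powi b"
  have nz: "?A \<noteq> 0" "?B \<noteq> 0" "?q \<noteq> 0" using q_par_nonzero by auto
  have "(?B - inverse ?B) * (?A * ?q - inverse (?A * ?q)) -
      (?A - inverse ?A) * (?B * ?q - inverse (?B * ?q)) =
      (inverse ?A * ?B - ?A * inverse ?B) * ?d"
    using nz by (simp add: field_simps)
  hence "(?B - inverse ?B) / ?d * ((?A * ?q - inverse (?A * ?q)) / ?d) -
      (?A - inverse ?A) / ?d * ((?B * ?q - inverse (?B * ?q)) / ?d) =
      (inverse ?A * ?B - ?A * inverse ?B) * ?d / (?d * ?d)"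
    by (simp add: diff_divide_distrib[symmetric])
  moreover have "?q powi (- (c + 1)) = inverse (?q powi c * ?q)" "?q powi (c + 1) = ?q powi c * ?q" for c
    unfolding power_int_minus using nz by (simp_all add: power_int_add)
  ultimately show ?thesis
    unfolding qint_def using q_par_denominator nz by (simp only: power_int_minus) simp
qed

text \<open>Moving a particle to another site and back is diagonal. At two bosonic sites the
  claim is the identity \<open>[b][a + 1] - [a][b + 1] = [b - a]\<close>; a fermionic site has occupation 0 or 1,
  where the parameter \<open>- q\<^sup>-\<^sup>1\<close> in place of \<open>q\<close> accounts for the products that the exclusion rule
  sets to 0.\<close>

lemma hop_commutator:
  assumes m: "valid_index n \<kappa> m" and st: "s \<in> {1..n}" "t \<in> {1..n}" "s \<noteq> t"
  shows "hop n \<kappa> s t (hop n \<kappa> t s (ket n \<kappa> m)) - hop n \<kappa> t s (hop n \<kappa> s t (ket n \<kappa> m)) =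
    pscale ((hop_weight \<kappa> s t m - inverse (hop_weight \<kappa> s t m)) / (q_par - inverse q_par)) (ket n \<kappa> m)"
proof -
  have bound: "0 \<le> m s" "0 \<le> m t" "s \<le> \<kappa> \<Longrightarrow> m s = 0 \<or> m s = 1" "t \<le> \<kappa> \<Longrightarrow> m t = 0 \<or> m t = 1"
    using m st by (force simp: valid_index_def)+
  have round_trip: "hop n \<kappa> v u (hop n \<kappa> u v (ket n \<kappa> m)) =
      pscale (if v \<le> \<kappa> \<and> m v = 1 then 0 else qint (m u) * qint (m v + 1)) (ket n \<kappa> m)"
    if "{u, v} = {s, t}" for u v
  proof -
    have uv: "u \<in> {1..n}" "v \<in> {1..n}" "u \<noteq> v" using that st by (auto simp: doubleton_eq_iff)
    have bv: "0 \<le> m u" "v \<le> \<kappa> \<Longrightarrow> m v = 0 \<or> m v = 1"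
      using that bound by (auto simp: doubleton_eq_iff)
    show ?thesis
    proof (cases "valid_index n \<kappa> (move u v m)")
      case True
      hence "\<not> (v \<le> \<kappa> \<and> m v = 1)" using valid_index_move[OF m uv] by auto
      thus ?thesis using True uv by (auto simp: hop_ket m plinearD[OF plinear_hop] move_apply)
    next
      case False
      hence "m u = 0 \<or> v \<le> \<kappa> \<and> m v = 1" using valid_index_move[OF m uv] bv by auto
      thus ?thesis
        using False by (auto simp: hop_ket m ket_def[of _ _ "move u v m"] plinearD[OF plinear_hop])
    qed
  qed
  have d: "q_par - inverse q_par \<noteq> 0" by (rule q_par_denominator)
  note nz = q_par_nonzero
  have "(if s \<le> \<kappa> \<and> m s = 1 then 0 else qint (m t) * qint (m s + 1)) -
      (if t \<le> \<kappa> \<and> m t = 1 then 0 else qint (m s) * qint (m t + 1)) =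
      (hop_weight \<kappa> s t m - inverse (hop_weight \<kappa> s t m)) / (q_par - inverse q_par)"
  proof -
    consider "s \<le> \<kappa>" "t \<le> \<kappa>" | "s \<le> \<kappa>" "\<not> t \<le> \<kappa>" | "\<not> s \<le> \<kappa>" "t \<le> \<kappa>" | "\<not> s \<le> \<kappa>" "\<not> t \<le> \<kappa>"
      by blast
    thus ?thesis
    proof cases
      case 1
      have "(- inverse q_par + q_par) / (q_par - inverse q_par) = 1"
        "(- q_par + inverse q_par) / (q_par - inverse q_par) = - 1"
        using d by (simp_all add: field_simps)
      thus ?thesis using 1 bound(3,4) nz
        by (auto simp: hop_weight_def site_q_def power_int_minus)
    next
      case 2
      hence "m s = 0 \<or> m s = 1" using bound(3) by blast
      thus ?thesis
      proof
        assume "m s = 0"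
        thus ?thesis using 2 qint_eq[of "m t"] by (simp add: hop_weight_def site_q_def)
      next
        assume "m s = 1"
        thus ?thesis using 2 qint_eq[of "m t + 1"] nz
          by (simp add: hop_weight_def site_q_def power_int_minus power_int_add
              minus_divide_left mult.commute)
      qed
    next
      case 3
      hence "m t = 0 \<or> m t = 1" using bound(4) by blast
      thus ?thesis
      proof
        assume "m t = 0"
        thus ?thesis using 3 qint_eq[of "m s"]
          by (simp add: hop_weight_def site_q_def power_int_minus minus_divide_left)
      next
        assume "m t = 1"
        thus ?thesis using 3 qint_eq[of "m s + 1"] nz
          by (simp add: hop_weight_def site_q_def power_int_minus power_int_add
              minus_divide_left mult.commute)
      qed
    next
      case 4
      thus ?thesis using qint_commutator[of "m t" "m s"]
        by (simp add: hop_weight_def site_q_def power_int_minus)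
    qed
  qed
  thus ?thesis
    using round_trip[of t s] round_trip[of s t] by (simp add: insert_commute pm.scale_left_diff_distrib[symmetric])
qed

lemma pos_eq: "i < n \<Longrightarrow> pos n i = (if i = 0 then n else i)" "i < n \<Longrightarrow> pos n (Suc i) = Suc i"
  by (auto simp: pos_def mod_Suc)

lemma pos_in_range:
  assumes "i < n"
  shows "pos n i \<in> {1..n}" "pos n (Suc i) \<in> {1..n}"
  using assms by (auto simp: pos_eq)

lemma pos_self: "s \<in> {1..n} \<Longrightarrow> pos n s = s"
  by (cases "s = n") (auto simp: pos_def)

lemma pos_neq:
  assumes "2 \<le> n" "i < n"
  shows "pos n i \<noteq> pos n (Suc i)"
  using assms by (simp add: pos_eq)

lemma pos_inj:
  assumes "i < n" "j < n"
  shows "pos n i = pos n j \<longleftrightarrow> i = j" "pos n (Suc i) = pos n (Suc j) \<longleftrightarrow> i = j"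
  using assms by (auto simp: pos_eq)

text \<open>The product defining \<open>D\<^sub>i\<^sub>,\<^sub>j\<close>, in the form in which it arises from the change of the
  eigenvalue of \<open>k\<^sub>i\<close> under a hop from \<open>a\<close> to \<open>b\<close>; exchanging \<open>a\<close> and \<open>b\<close> inverts it, as needed for
  \<open>f\<^sub>j\<close>.\<close>

lemma D_coeff_eq:
  assumes n: "2 \<le> n" and ij: "i < n" "j < n"
  defines "s \<equiv> pos n i" and "t \<equiv> pos n (Suc i)" and "a \<equiv> pos n j" and "b \<equiv> pos n (Suc j)"
  shows "D_coeff n (ones_zeros \<kappa>) i j = site_q \<kappa> s powi (of_bool (s = a) - of_bool (s = b)) *
    site_q \<kappa> t powi (of_bool (t = b) - of_bool (t = a))"
proof -
  have ne: "s \<noteq> t" "a \<noteq> b" using pos_neq n ij by (auto simp: s_def t_def a_def b_def)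
  have eq: "s = a \<longleftrightarrow> i = j" "t = b \<longleftrightarrow> i = j"
    using pos_inj ij unfolding s_def t_def a_def b_def by blast+
  have pp: "pos n s = s" "pos n t = t" "pos n a = a" "pos n b = b"
    using pos_self pos_in_range[OF ij(1)] pos_in_range[OF ij(2)]
    unfolding s_def t_def a_def b_def by blast+
  show ?thesis
  proof (cases "i = j")
    case True
    hence "s = a" "t = b" by (auto simp: eq)
    thus ?thesis
      unfolding D_coeff_def Suc_eq_plus1[symmetric] s_def[symmetric] t_def[symmetric] a_def[symmetric] b_def[symmetric]
      using ne True pp by (simp add: q_idx_ones_zeros)
  next
    case False
    hence "s \<noteq> a" "t \<noteq> b" by (auto simp: eq)
    hence "{s, t} \<inter> {a, b} = (if s = b then {s} else {}) \<union> (if t = a then {t} else {})"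
      using ne by auto
    thus ?thesis
      unfolding D_coeff_def Suc_eq_plus1[symmetric] s_def[symmetric] t_def[symmetric] a_def[symmetric] b_def[symmetric]
      using ne False eq pp by (simp add: q_idx_ones_zeros power_int_minus)
  qed
qed

lemma plinear_pscale: "plinear A \<Longrightarrow> plinear (\<lambda>v. pscale c (A v))"
  and plinear_add: "plinear A \<Longrightarrow> plinear B \<Longrightarrow> plinear (\<lambda>v. A v + B v)"
  and plinear_diff: "plinear A \<Longrightarrow> plinear B \<Longrightarrow> plinear (\<lambda>v. A v - B v)"
  by (rule plinearI; simp add: plinearD pm.scale_right_distrib pm.scale_right_diff_distrib mult.commute)+

lemma word_action_pi_rep: "word_action (pi_rep n \<kappa> z)"
proof (rule word_action.intro)
  have word: "pi_rep n \<kappa> z (Poly_Mapping.single w 1) v =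
      foldr (\<lambda>g. lin_ext (pi_gen n \<kappa> z g)) (letters w) v" for w v
    by (simp add: pi_rep_def)
  have "plinear (\<lambda>v. foldr (\<lambda>g. lin_ext (pi_gen n \<kappa> z g)) gs v)" for gs
    by (induction gs) (auto simp: plinear_id intro: plinear_compose[OF plinear_lin_ext])
  moreover have "pi_rep n \<kappa> z (Poly_Mapping.single w 1) =
      (\<lambda>v. foldr (\<lambda>g. lin_ext (pi_gen n \<kappa> z g)) (letters w) v)" for w
    using word by blast
  ultimately have *: "plinear (pi_rep n \<kappa> z (Poly_Mapping.single w 1))" for w
    by simp
  show "plinear (pi_rep n \<kappa> z (Poly_Mapping.single w 1))" for w by (rule *)
  show "pi_rep n \<kappa> z (Poly_Mapping.single 0 1) v = v" for v
    unfolding word by (simp add: zero_word_def)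
  show "pi_rep n \<kappa> z (Poly_Mapping.single (u + w) 1) v =
      pi_rep n \<kappa> z (Poly_Mapping.single u 1) (pi_rep n \<kappa> z (Poly_Mapping.single w 1) v)" for u w v
    by (simp add: word plus_word_def)
qed

lemma pi_rep_gen: "pi_rep n \<kappa> z (gen g) = lin_ext (pi_gen n \<kappa> z g)"
  by (simp add: pi_rep_def gen_def fun_eq_iff)

lemma plinear_pi_rep_gen: "plinear (pi_rep n \<kappa> z (gen g))"
  unfolding pi_rep_gen by (rule plinear_lin_ext)

lemma pi_rep_E: "pi_rep n \<kappa> z (gen (E i)) v =
    pscale (if i = 0 then z else 1) (hop n \<kappa> (pos n i) (pos n (Suc i)) v)"
  by (rule plinear_eqI[OF plinear_pi_rep_gen plinear_pscale[OF plinear_hop]])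
    (simp add: pi_rep_gen hop_def move_def)

lemma pi_rep_F: "pi_rep n \<kappa> z (gen (F i)) v =
    pscale (if i = 0 then inverse z else 1) (hop n \<kappa> (pos n (Suc i)) (pos n i) v)"
  by (rule plinear_eqI[OF plinear_pi_rep_gen plinear_pscale[OF plinear_hop]])
    (simp add: pi_rep_gen hop_def move_def algebra_simps)

lemma pi_rep_K:
  "pi_rep n \<kappa> z (gen (K i)) (ket n \<kappa> m) =
     pscale (hop_weight \<kappa> (pos n i) (pos n (Suc i)) m) (ket n \<kappa> m)"
  "pi_rep n \<kappa> z (gen (Kinv i)) (ket n \<kappa> m) =
     pscale (inverse (hop_weight \<kappa> (pos n i) (pos n (Suc i)) m)) (ket n \<kappa> m)"
  by (simp_all add: pi_rep_gen ket_def hop_weight_def q_idx_ones_zeros plinearD[OF plinear_lin_ext])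

lemma hop_preserve_basis:
  assumes "m \<in> basis n \<kappa> l" "s \<in> {1..n}" "t \<in> {1..n}"
  shows "hop n \<kappa> s t (ket n \<kappa> m) \<in> W_space n \<kappa> l"
proof (cases "valid_index n \<kappa> (move s t m)")
  case True
  hence "ket n \<kappa> (move s t m) \<in> W_space n \<kappa> l"
    using move_in_basis[OF assms True] unfolding W_space_eq_span by (intro pm.span_base) blast
  thus ?thesis
    using assms(1) unfolding W_space_eq_span by (simp add: hop_ket basis_def pm.span_scale)
next
  case False
  thus ?thesis using assms unfolding W_space_eq_span
    by (simp add: hop_ket basis_def ket_def[of _ _ "move s t m"] pm.span_zero)
qed

lemma UA_word_action_pi_rep:
  assumes n: "2 \<le> n" and z: "z \<noteq> 0"
  shows "UA_word_action (pi_rep n \<kappa> z) n (ones_zeros \<kappa>) (W_space n \<kappa> l)"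
proof -
  interpret word_action "pi_rep n \<kappa> z" by (rule word_action_pi_rep)
  let ?\<rho> = "pi_rep n \<kappa> z" and ?W = "W_space n \<kappa> l"
  have eqI: "A v = B v" if "v \<in> ?W" "plinear A" "plinear B"
      "\<And>m. valid_index n \<kappa> m \<Longrightarrow> A (ket n \<kappa> m) = B (ket n \<kappa> m)" for A B v
    using that(1) unfolding W_space_eq_span
    by (rule plinear_eq_on_span[OF that(2,3), rotated]) (auto simp: basis_def that(4))
  note lin = plinear_pi_rep_gen plinear_compose[OF plinear_pi_rep_gen] plinear_id plinear_pscale
    plinear_add plinear_diff
  note simps = pi_rep_E pi_rep_F pi_rep_K hop_ket plinearD[OF plinear_pi_rep_gen]
    plinearD[OF plinear_hop] hop_weight_nonzero hop_weight_move
  have K_hop: "?\<rho> (gen (K i)) (hop n \<kappa> a b (ket n \<kappa> m)) =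
      pscale (site_q \<kappa> s powi (of_bool (s = a) - of_bool (s = b)) *
        site_q \<kappa> t powi (of_bool (t = b) - of_bool (t = a))) (hop n \<kappa> a b (?\<rho> (gen (K i)) (ket n \<kappa> m)))"
    if "valid_index n \<kappa> m" "a \<noteq> b" "s = pos n i" "t = pos n (Suc i)" for i a b s t m
    using that by (simp add: simps mult.assoc mult.left_commute)
  show ?thesis
  proof
    fix g v assume g: "g \<in> generators n" and v: "v \<in> ?W"
    show "?\<rho> (gen g) v \<in> ?W"
    proof (rule plinear_span_subset[OF plinear_pi_rep_gen _ _ v[unfolded W_space_eq_span]])
      show sub: "pm.subspace ?W" unfolding W_space_eq_span by (rule pm.subspace_span)
      fix u assume "u \<in> ket n \<kappa> ` basis n \<kappa> l"
      then obtain m where m: "m \<in> basis n \<kappa> l" "u = ket n \<kappa> m" by blast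
      have "u \<in> ?W" unfolding W_space_eq_span m(2) using m(1) by (intro pm.span_base) blast
      thus "?\<rho> (gen g) u \<in> ?W"
        using g m pos_in_range
        by (auto simp: generators_def pi_rep_E pi_rep_F pi_rep_K
            intro!: pm.subspace_scale[OF sub] hop_preserve_basis)
    qed
  next
    fix i v assume "i < n" and v: "v \<in> ?W"
    show "?\<rho> (gen (K i)) (?\<rho> (gen (Kinv i)) v) = v"
      by (rule eqI[OF v]) (auto intro: lin simp: simps)
    show "?\<rho> (gen (Kinv i)) (?\<rho> (gen (K i)) v) = v"
      by (rule eqI[OF v]) (auto intro: lin simp: simps)
  next
    fix i j v assume ij: "i < n" "j < n" and v: "v \<in> ?W"
    let ?s = "pos n i" and ?t = "pos n (Suc i)" and ?a = "pos n j" and ?b = "pos n (Suc j)"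
    have ne: "?s \<noteq> ?t" "?a \<noteq> ?b" using pos_neq n ij by blast+
    show "?\<rho> (gen (K i)) (?\<rho> (gen (K j)) v) = ?\<rho> (gen (K j)) (?\<rho> (gen (K i)) v)"
      by (rule eqI[OF v]) (auto intro: lin simp: simps mult.commute)
    show "?\<rho> (gen (K i)) (?\<rho> (gen (E j)) v) =
        pscale (D_coeff n (ones_zeros \<kappa>) i j) (?\<rho> (gen (E j)) (?\<rho> (gen (K i)) v))"
    proof (rule eqI[OF v])
      fix m assume "valid_index n \<kappa> m"
      from K_hop[OF this ne(2) refl refl, of i]
      show "?\<rho> (gen (K i)) (?\<rho> (gen (E j)) (ket n \<kappa> m)) =
          pscale (D_coeff n (ones_zeros \<kappa>) i j) (?\<rho> (gen (E j)) (?\<rho> (gen (K i)) (ket n \<kappa> m)))"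
        unfolding D_coeff_eq[OF n ij] pi_rep_E plinearD(2)[OF plinear_pi_rep_gen]
        by (simp only: pm.scale_left_commute)
    qed (intro lin)+
    have D_inv: "inverse (D_coeff n (ones_zeros \<kappa>) i j) =
        site_q \<kappa> ?s powi (of_bool (?s = ?b) - of_bool (?s = ?a)) *
        site_q \<kappa> ?t powi (of_bool (?t = ?a) - of_bool (?t = ?b))"
      unfolding D_coeff_eq[OF n ij] inverse_mult_distrib power_int_minus[symmetric] by simp
    show "?\<rho> (gen (K i)) (?\<rho> (gen (F j)) v) =
        pscale (inverse (D_coeff n (ones_zeros \<kappa>) i j)) (?\<rho> (gen (F j)) (?\<rho> (gen (K i)) v))"
    proof (rule eqI[OF v])
      fix m assume "valid_index n \<kappa> m"
      from K_hop[OF this ne(2)[symmetric] refl refl, of i]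
      show "?\<rho> (gen (K i)) (?\<rho> (gen (F j)) (ket n \<kappa> m)) =
          pscale (inverse (D_coeff n (ones_zeros \<kappa>) i j))
            (?\<rho> (gen (F j)) (?\<rho> (gen (K i)) (ket n \<kappa> m)))"
        unfolding D_inv pi_rep_F plinearD(2)[OF plinear_pi_rep_gen]
        by (simp only: pm.scale_left_commute)
    qed (intro lin)+
    show "?\<rho> (gen (E i)) (?\<rho> (gen (F j)) v) = ?\<rho> (gen (F j)) (?\<rho> (gen (E i)) v) +
        (if i = j then pscale (1 / (q_par - inverse q_par)) (?\<rho> (gen (K i)) v - ?\<rho> (gen (Kinv i)) v)
         else 0)"
    proof (cases "i = j")
      case True
      have "?\<rho> (gen (E i)) (?\<rho> (gen (F i)) v) = ?\<rho> (gen (F i)) (?\<rho> (gen (E i)) v) +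
          pscale (1 / (q_par - inverse q_par)) (?\<rho> (gen (K i)) v - ?\<rho> (gen (Kinv i)) v)"
      proof (rule eqI[OF v])
        fix m assume m: "valid_index n \<kappa> m"
        have "?\<rho> (gen (E i)) (?\<rho> (gen (F i)) (ket n \<kappa> m)) - ?\<rho> (gen (F i)) (?\<rho> (gen (E i)) (ket n \<kappa> m)) =
            hop n \<kappa> ?s ?t (hop n \<kappa> ?t ?s (ket n \<kappa> m)) - hop n \<kappa> ?t ?s (hop n \<kappa> ?s ?t (ket n \<kappa> m))"
          using z by (simp add: pi_rep_E pi_rep_F plinearD[OF plinear_hop])
        also have "\<dots> = pscale (1 / (q_par - inverse q_par))
            (?\<rho> (gen (K i)) (ket n \<kappa> m) - ?\<rho> (gen (Kinv i)) (ket n \<kappa> m))"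
          unfolding hop_commutator[OF m pos_in_range[OF ij(1)] ne(1)] pi_rep_K
          by (simp add: pm.scale_left_diff_distrib[symmetric])
        finally show "?\<rho> (gen (E i)) (?\<rho> (gen (F i)) (ket n \<kappa> m)) =
            ?\<rho> (gen (F i)) (?\<rho> (gen (E i)) (ket n \<kappa> m)) + pscale (1 / (q_par - inverse q_par))
            (?\<rho> (gen (K i)) (ket n \<kappa> m) - ?\<rho> (gen (Kinv i)) (ket n \<kappa> m))"
          by (simp add: algebra_simps)
      qed (intro lin)+
      thus ?thesis using True by simp
    next
      case False
      have "?\<rho> (gen (E i)) (?\<rho> (gen (F j)) v) = ?\<rho> (gen (F j)) (?\<rho> (gen (E i)) v)"
      proof (rule eqI[OF v])
        fix m assume m: "valid_index n \<kappa> m"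
        have "hop n \<kappa> ?s ?t (hop n \<kappa> ?b ?a (ket n \<kappa> m)) = hop n \<kappa> ?b ?a (hop n \<kappa> ?s ?t (ket n \<kappa> m))"
        proof (rule hop_commute[OF m])
          show "{?s, ?t, ?b, ?a} \<subseteq> {1..n}" using pos_in_range ij by blast
          show "?s \<noteq> ?t" "?b \<noteq> ?a" using ne by auto
          show "?s \<noteq> ?a" "?t \<noteq> ?b" using pos_inj[OF ij] False by blast+
        qed
        thus "?\<rho> (gen (E i)) (?\<rho> (gen (F j)) (ket n \<kappa> m)) =
            ?\<rho> (gen (F j)) (?\<rho> (gen (E i)) (ket n \<kappa> m))"
          unfolding pi_rep_E pi_rep_F plinearD(2)[OF plinear_hop]
          by (simp only: pm.scale_left_commute)
      qed (intro lin)+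
      thus ?thesis using False by simp
    qed
  qed
qed

section \<open>Irreducibility\<close>

lemma finite_basis: "finite (basis n \<kappa> l)"
proof (rule finite_subset)
  show "finite {m :: multi_index. \<forall>i. (i \<in> {1..n} \<longrightarrow> m i \<in> {0..int l}) \<and> (i \<notin> {1..n} \<longrightarrow> m i = 0)}"
    by (rule finite_set_of_finite_funs) auto
  show "basis n \<kappa> l \<subseteq>
      {m. \<forall>i. (i \<in> {1..n} \<longrightarrow> m i \<in> {0..int l}) \<and> (i \<notin> {1..n} \<longrightarrow> m i = 0)}"
  proof (intro subsetI CollectI allI conjI impI)
    fix m i assume m: "m \<in> basis n \<kappa> l"
    show "m i = 0" if "i \<notin> {1..n}" using m that by (simp add: basis_def valid_index_def)
    assume i: "i \<in> {1..n}"
    have "m i \<le> (\<Sum>i=1..n. m i)"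
      using m i by (intro member_le_sum) (auto simp: basis_def valid_index_def)
    thus "m i \<in> {0..int l}" using m i by (auto simp: basis_def valid_index_def)
  qed
qed

lemma keys_W_space:
  assumes "v \<in> W_space n \<kappa> l"
  shows "Poly_Mapping.keys v \<subseteq> basis n \<kappa> l"
  using assms unfolding W_space_eq_span
proof (induction rule: pm.span_induct_alt)
  case (step c x y)
  have "Poly_Mapping.keys (pscale c x + y) \<subseteq> Poly_Mapping.keys x \<union> Poly_Mapping.keys y"
    by (auto simp: in_keys_iff lookup_add)
  thus ?case using step by (auto simp: ket_def split: if_splits)
qed simp

lemma keys_tensor_space:
  assumes "p \<in> tensor_space (W_space n \<kappa> l) (W_space n \<kappa> m)"
  shows "Poly_Mapping.keys p \<subseteq> basis n \<kappa> l \<times> basis n \<kappa> m"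
  using assms unfolding tensor_space_def
proof (induction rule: pm.span_induct_alt)
  case (step c x y)
  then obtain v w where x: "x = tensor v w" "v \<in> W_space n \<kappa> l" "w \<in> W_space n \<kappa> m" by blast
  have "Poly_Mapping.keys x \<subseteq> Poly_Mapping.keys v \<times> Poly_Mapping.keys w"
    by (auto simp: x(1) in_keys_iff)
  moreover have "Poly_Mapping.keys (pscale c x + y) \<subseteq> Poly_Mapping.keys x \<union> Poly_Mapping.keys y"
    by (auto simp: in_keys_iff lookup_add)
  ultimately show ?case using step.IH keys_W_space x by blast
qed simp

definition top_index :: "nat \<Rightarrow> nat \<Rightarrow> multi_index" where
  "top_index n l = (\<lambda>j. if j = n then int l else 0)"

lemma top_index_in_basis: "\<kappa> < n \<Longrightarrow> top_index n l \<in> basis n \<kappa> l"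
  by (auto simp: basis_def top_index_def valid_index_def)

lemma ex_occupied_below_top:
  assumes m: "m \<in> basis n \<kappa> l" "m \<noteq> top_index n l" and n: "1 \<le> n"
  shows "{j \<in> {1..<n}. 0 < m j} \<noteq> {}"
proof
  assume empty: "{j \<in> {1..<n}. 0 < m j} = {}"
  have nonneg: "0 \<le> m j" if "j \<in> {1..n}" for j
    using m(1) that by (simp add: basis_def valid_index_def)
  have z: "m j = 0" if "j \<noteq> n" for j
  proof (cases "j \<in> {1..<n}")
    case True
    moreover hence "\<not> 0 < m j" using empty by blast
    ultimately show ?thesis using nonneg[of j] by auto
  next
    case False
    thus ?thesis using m(1) that by (auto simp: basis_def valid_index_def)
  qed
  have "(\<Sum>i=1..n. m i) = (\<Sum>i=1..n. if i = n then m n else 0)"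
    using z by (intro sum.cong) auto
  also have "\<dots> = m n" using n by simp
  finally have "m n = int l" using m(1) by (simp add: basis_def)
  hence "m = top_index n l" using z by (auto simp: top_index_def)
  thus False using m(2) by blast
qed

text \<open>The occupied site below \<open>n\<close> that is closest to \<open>n\<close> has an empty neighbour above it, or the
  bosonic neighbour \<open>n\<close>. The opposite choice, the occupied site closest to \<open>1\<close>, works for moves
  downwards, where \<open>n\<close> is the neighbour below \<open>1\<close>.\<close>

lemma ex_move_up:
  assumes "m \<in> basis n \<kappa> l" "m \<noteq> top_index n l" "\<kappa> < n"
  shows "\<exists>i\<in>{1..<n}. move i (Suc i) m \<in> basis n \<kappa> l"
proof -
  let ?J = "{j \<in> {1..<n}. 0 < m j}"
  have J: "finite ?J" "?J \<noteq> {}" using ex_occupied_below_top[of m n \<kappa> l] assms by auto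
  define i where "i = Max ?J"
  have i: "i \<in> ?J" unfolding i_def using J by (rule Max_in)
  have "m (Suc i) = 0" if "Suc i \<le> \<kappa>"
  proof -
    have "Suc i \<notin> ?J" using Max_ge[OF J(1), of "Suc i"] unfolding i_def[symmetric] by auto
    moreover have "0 \<le> m (Suc i)" using assms that by (auto simp: basis_def valid_index_def)
    ultimately show ?thesis using that assms(3) by auto
  qed
  hence "valid_index n \<kappa> (move i (Suc i) m)"
    using valid_index_move[of n \<kappa> m i "Suc i"] assms(1) i by (auto simp: basis_def)
  hence "move i (Suc i) m \<in> basis n \<kappa> l"
    using i by (intro move_in_basis[OF assms(1)]) auto
  thus ?thesis using i by auto
qed

lemma ex_move_down:
  assumes "m \<in> basis n \<kappa> l" "m \<noteq> top_index n l" "\<kappa> < n"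
  shows "\<exists>i<n - 1. move (Suc i) (pos n i) m \<in> basis n \<kappa> l"
proof -
  let ?J = "{j \<in> {1..<n}. 0 < m j}"
  have J: "finite ?J" "?J \<noteq> {}" using ex_occupied_below_top[of m n \<kappa> l] assms by auto
  define j where "j = Min ?J"
  have j: "j \<in> ?J" unfolding j_def using J by (rule Min_in)
  define i where "i = j - 1"
  have i: "j = Suc i" "i < n - 1" "i < n" using j by (auto simp: i_def)
  have "m (pos n i) = 0" if "pos n i \<le> \<kappa>"
  proof -
    have p: "pos n i = i" "0 < i" using that i assms(3) by (auto simp: pos_eq split: if_splits)
    have "i \<notin> ?J" using Min_le[OF J(1), of i] i(1) unfolding j_def[symmetric] by auto
    moreover have "0 \<le> m i" using assms(1) p i by (auto simp: basis_def valid_index_def)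
    ultimately show ?thesis using p i by auto
  qed
  moreover have "pos n i \<noteq> Suc i" using pos_neq[of n i] i by (auto simp: pos_eq)
  ultimately have "valid_index n \<kappa> (move (Suc i) (pos n i) m)"
    using valid_index_move[of n \<kappa> m "Suc i" "pos n i"] assms(1) j i pos_in_range(1)[OF i(3)]
    by (auto simp: basis_def)
  thus ?thesis
    using move_in_basis[OF assms(1), of "Suc i" "pos n i"] i pos_in_range(1)[OF i(3)] by auto
qed

definition linear_form :: "nat \<Rightarrow> (nat \<Rightarrow> int) \<Rightarrow> multi_index \<Rightarrow> int" where
  "linear_form n f m = (\<Sum>i=1..n. f i * m i)"

lemma linear_form_move:
  "s \<in> {1..n} \<Longrightarrow> t \<in> {1..n} \<Longrightarrow> linear_form n f (move s t m) = linear_form n f m - f s + f t"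
  unfolding linear_form_def by (rule sum_move)

lemma linear_form_nonneg:
  "m \<in> basis n \<kappa> l \<Longrightarrow> (\<And>i. i \<in> {1..n} \<Longrightarrow> 0 \<le> f i) \<Longrightarrow> 0 \<le> linear_form n f m"
  unfolding linear_form_def by (rule sum_nonneg) (simp add: basis_def valid_index_def)

text \<open>The numbers of moves that bring all particles to site \<open>n\<close>, going up, respectively going
  down and from \<open>1\<close> to \<open>n\<close>.\<close>

definition up_steps :: "nat \<Rightarrow> multi_index \<Rightarrow> int" where
  "up_steps n = linear_form n (\<lambda>j. int n - int j)"

definition down_steps :: "nat \<Rightarrow> multi_index \<Rightarrow> int" where
  "down_steps n = linear_form n (\<lambda>j. if j = n then 0 else int j)"

lemma steps_nonneg:
  assumes "m \<in> basis n \<kappa> l"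
  shows "0 \<le> up_steps n m" "0 \<le> down_steps n m"
  unfolding up_steps_def down_steps_def
  by (rule linear_form_nonneg[OF assms]; simp)+

lemma up_steps_move: "i \<in> {1..<n} \<Longrightarrow> up_steps n (move i (Suc i) m) = up_steps n m - 1"
  by (simp add: up_steps_def linear_form_move)

lemma down_steps_move:
  assumes "i < n - 1"
  shows "down_steps n (move (Suc i) (pos n i) m) = down_steps n m - 1"
proof -
  have "i < n" using assms by simp
  thus ?thesis
    using assms pos_in_range(1)[of i n]
    by (cases "i = 0") (auto simp: down_steps_def linear_form_move pos_eq)
qed

text \<open>Chosen so that every \<open>1 \<otimes> e\<^sub>i\<close>, including \<open>i = 0\<close> with its factor \<open>y\<close> of absolute value
  \<open>2\<^sup>n\<close>, scales sizes by the same factor 2.\<close>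

definition weight :: "nat \<Rightarrow> multi_index \<times> multi_index \<Rightarrow> real" where
  "weight n s = 2 powi linear_form n int (snd s)"

text \<open>The leading parts \<open>1 \<otimes> e\<^sub>i\<close> and \<open>f\<^sub>i \<otimes> 1\<close> as partial maps on pairs of indices.\<close>

fun move_domain :: "nat \<Rightarrow> nat \<Rightarrow> generator \<Rightarrow> (multi_index \<times> multi_index) set" where
  "move_domain n \<kappa> (E i) = {(a, b). valid_index n \<kappa> (move (pos n i) (pos n (Suc i)) b)}"
| "move_domain n \<kappa> (F i) = {(a, b). valid_index n \<kappa> (move (pos n (Suc i)) (pos n i) a)}"
| "move_domain n \<kappa> _ = {}"

fun move_pair :: "nat \<Rightarrow> generator \<Rightarrow> multi_index \<times> multi_index \<Rightarrow> multi_index \<times> multi_index" where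
  "move_pair n (E i) (a, b) = (a, move (pos n i) (pos n (Suc i)) b)"
| "move_pair n (F i) (a, b) = (move (pos n (Suc i)) (pos n i) a, b)"
| "move_pair n _ s = s"

fun move_scale :: "generator \<Rightarrow> real" where
  "move_scale (E i) = 2"
| "move_scale _ = 1"

definition EF_generators :: "nat \<Rightarrow> generator set" where
  "EF_generators n = (\<Union>i<n. {E i, F i})"

context
  fixes n \<kappa> l m :: nat
  assumes n: "2 \<le> n" and \<kappa>: "\<kappa> < n"
begin

interpretation nonarch_abs "degree_abs (2 ^ n) :: ground \<Rightarrow> real"
  using n by (intro nonarch_abs_degree_abs) simp

interpretation UA_word_action_pair "pi_rep n \<kappa> x_par" "pi_rep n \<kappa> y_par" n "ones_zeros \<kappa>"
    "W_space n \<kappa> l" "W_space n \<kappa> m"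
  by (intro UA_word_action_pair.intro UA_word_action_pi_rep n x_par_nonzero y_par_nonzero)

abbreviation abv :: "ground \<Rightarrow> real" where "abv \<equiv> degree_abs (2 ^ n)"

lemma abv_site_q: "abv (site_q \<kappa> s) = 1"
  by (simp add: site_q_def abv_inverse degree_abs_q_par)

lemma abv_hop_weight: "abv (hop_weight \<kappa> s t a) = 1"
  by (simp add: hop_weight_def abv_mult abv_powi abv_site_q)

lemma abv_qint: "0 < k \<Longrightarrow> abv (qint k) = 1"
  using n by (intro degree_abs_qint) simp_all

lemma abv_qint_le: "0 \<le> k \<Longrightarrow> abv (qint k) \<le> 1"
  using abv_qint[of k] by (cases "k = 0") auto

lemma weight_pos: "0 < weight n s"
  by (simp add: weight_def)

lemma lookup_tensor_ket:
  "Poly_Mapping.lookup (tensor (ket n \<kappa> a) (ket n \<kappa> b)) s =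
    (if s = (a, b) \<and> valid_index n \<kappa> a \<and> valid_index n \<kappa> b then 1 else 0)"
  by (cases s) (auto simp: ket_def lookup_single when_def)

text \<open>The remainder \<open>e\<^sub>i \<otimes> k\<^sub>i\<close> leaves the second index alone, hence the weight unchanged, and
  its coefficient is at most 1 in absolute value, as \<open>x\<close> is a constant for the degree in \<open>y\<close>.\<close>

lemma act_single_E:
  assumes i: "i < n" and s: "s \<in> basis n \<kappa> l \<times> basis n \<kappa> m"
  shows "\<exists>c R. act (gen (E i)) (Poly_Mapping.single s 1) =
      (if s \<in> move_domain n \<kappa> (E i) then Poly_Mapping.single (move_pair n (E i) s) c else 0) + R \<and>
      (s \<in> move_domain n \<kappa> (E i) \<longrightarrow>
        abv c * weight n (move_pair n (E i) s) = 2 * weight n s) \<and>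
      (\<forall>t. abv (Poly_Mapping.lookup R t) * weight n t < 2 * weight n s)"
proof -
  obtain a b where ab: "s = (a, b)" "a \<in> basis n \<kappa> l" "b \<in> basis n \<kappa> m" using s by blast
  let ?s = "pos n i" and ?t = "pos n (Suc i)"
  have v: "valid_index n \<kappa> a" "valid_index n \<kappa> b" using ab by (auto simp: basis_def)
  have st: "?s \<in> {1..n}" "?t \<in> {1..n}" "?s \<noteq> ?t" using pos_in_range[OF i] pos_neq[OF n i] by auto
  define c where "c = (if i = 0 then y_par else 1) * qint (b ?s)"
  define d where "d = (if i = 0 then x_par else 1) * qint (a ?s) * hop_weight \<kappa> ?s ?t b"
  define R where "R = pscale d (tensor (ket n \<kappa> (move ?s ?t a)) (ket n \<kappa> b))"
  have "Poly_Mapping.single s 1 = tensor (ket n \<kappa> a) (ket n \<kappa> b)"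
    using v by (simp add: ab(1) ket_def)
  hence "act (gen (E i)) (Poly_Mapping.single s 1) =
      pscale c (tensor (ket n \<kappa> a) (ket n \<kappa> (move ?s ?t b))) + R"
    using v by (simp add: tensor_action_gen pi_rep_E pi_rep_K hop_ket tensor_bilinear c_def R_def
        d_def mult_ac)
  also have "pscale c (tensor (ket n \<kappa> a) (ket n \<kappa> (move ?s ?t b))) =
      (if s \<in> move_domain n \<kappa> (E i) then Poly_Mapping.single (move_pair n (E i) s) c else 0)"
    using v by (auto simp: ab(1) ket_def tensor_bilinear intro!: poly_mapping_eqI
        simp: lookup_single when_def)
  finally have act: "act (gen (E i)) (Poly_Mapping.single s 1) =
    (if s \<in> move_domain n \<kappa> (E i) then Poly_Mapping.single (move_pair n (E i) s) c else 0) + R" .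
  have lead: "abv c * weight n (move_pair n (E i) s) = 2 * weight n s"
    if "s \<in> move_domain n \<kappa> (E i)"
  proof -
    have "1 \<le> b ?s" using that valid_index_move[OF v(2) st] by (simp add: ab(1))
    hence "abv c = (if i = 0 then 2 ^ n else 1)"
      by (simp add: c_def abv_mult abv_qint degree_abs_y_par)
    moreover have "linear_form n int (move ?s ?t b) =
        linear_form n int b + (if i = 0 then 1 - int n else 1)"
      using i st by (simp add: linear_form_move pos_eq)
    ultimately show ?thesis
      by (simp add: ab(1) weight_def power_int_add power_int_diff)
  qed
  have rest: "abv (Poly_Mapping.lookup R t) * weight n t < 2 * weight n s" for t
  proof (cases "Poly_Mapping.lookup R t = 0")
    case False
    hence "t = (move ?s ?t a, b)" "Poly_Mapping.lookup R t = d"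
      by (auto simp: R_def lookup_tensor_ket split: if_splits)
    moreover have "abv (qint (a ?s)) \<le> 1"
      using v st by (intro abv_qint_le) (auto simp: valid_index_def)
    hence "abv d \<le> 1"
      by (cases "i = 0") (simp_all add: d_def abv_mult abv_hop_weight degree_abs_x_par)
    hence "abv d * weight n s < 2 * weight n s"
      using weight_pos[of s] by (intro mult_strict_right_mono) auto
    ultimately show ?thesis by (simp add: ab(1) weight_def)
  qed (simp add: weight_pos)
  show ?thesis using act lead rest by blast
qed

text \<open>Here the remainder \<open>k\<^sub>i\<^sup>-\<^sup>1 \<otimes> f\<^sub>i\<close> moves a particle of the second index backwards, which
  halves the weight; for \<open>i = 0\<close> the weight grows by the factor \<open>2\<^sup>n\<^sup>-\<^sup>1\<close> and the factor \<open>y\<^sup>-\<^sup>1\<close> contributes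
  \<open>2\<^sup>-\<^sup>n\<close>.\<close>

lemma act_single_F:
  assumes i: "i < n" and s: "s \<in> basis n \<kappa> l \<times> basis n \<kappa> m"
  shows "\<exists>c R. act (gen (F i)) (Poly_Mapping.single s 1) =
      (if s \<in> move_domain n \<kappa> (F i) then Poly_Mapping.single (move_pair n (F i) s) c else 0) + R \<and>
      (s \<in> move_domain n \<kappa> (F i) \<longrightarrow>
        abv c * weight n (move_pair n (F i) s) = 1 * weight n s) \<and>
      (\<forall>t. abv (Poly_Mapping.lookup R t) * weight n t < 1 * weight n s)"
proof -
  obtain a b where ab: "s = (a, b)" "a \<in> basis n \<kappa> l" "b \<in> basis n \<kappa> m" using s by blast
  let ?s = "pos n i" and ?t = "pos n (Suc i)"
  have v: "valid_index n \<kappa> a" "valid_index n \<kappa> b" using ab by (auto simp: basis_def)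
  have st: "?s \<in> {1..n}" "?t \<in> {1..n}" "?s \<noteq> ?t" using pos_in_range[OF i] pos_neq[OF n i] by auto
  define c where "c = (if i = 0 then inverse x_par else 1) * qint (a ?t)"
  define d where
    "d = inverse (hop_weight \<kappa> ?s ?t a) * ((if i = 0 then inverse y_par else 1) * qint (b ?t))"
  define R where "R = pscale d (tensor (ket n \<kappa> a) (ket n \<kappa> (move ?t ?s b)))"
  have "Poly_Mapping.single s 1 = tensor (ket n \<kappa> a) (ket n \<kappa> b)"
    using v by (simp add: ab(1) ket_def)
  hence "act (gen (F i)) (Poly_Mapping.single s 1) =
      pscale c (tensor (ket n \<kappa> (move ?t ?s a)) (ket n \<kappa> b)) + R"
    using v by (simp add: tensor_action_gen pi_rep_F pi_rep_K hop_ket tensor_bilinear c_def R_def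
        d_def mult_ac)
  also have "pscale c (tensor (ket n \<kappa> (move ?t ?s a)) (ket n \<kappa> b)) =
      (if s \<in> move_domain n \<kappa> (F i) then Poly_Mapping.single (move_pair n (F i) s) c else 0)"
    using v by (auto simp: ab(1) ket_def tensor_bilinear intro!: poly_mapping_eqI
        simp: lookup_single when_def)
  finally have act: "act (gen (F i)) (Poly_Mapping.single s 1) =
    (if s \<in> move_domain n \<kappa> (F i) then Poly_Mapping.single (move_pair n (F i) s) c else 0) + R" .
  have lead: "abv c * weight n (move_pair n (F i) s) = 1 * weight n s"
    if "s \<in> move_domain n \<kappa> (F i)"
  proof -
    have "1 \<le> a ?t" using that valid_index_move[OF v(1) st(2,1) st(3)[symmetric]] by (simp add: ab(1))
    thus ?thesis
      by (simp add: c_def abv_mult abv_qint abv_inverse degree_abs_x_par ab(1) weight_def)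
  qed
  have rest: "abv (Poly_Mapping.lookup R t) * weight n t < 1 * weight n s" for t
  proof (cases "Poly_Mapping.lookup R t = 0")
    case False
    hence t: "t = (a, move ?t ?s b)" "Poly_Mapping.lookup R t = d"
      by (auto simp: R_def lookup_tensor_ket split: if_splits)
    have "linear_form n int (move ?t ?s b) = linear_form n int b + (if i = 0 then int n - 1 else - 1)"
      using i st by (simp add: linear_form_move pos_eq)
    moreover have "abv d = (if i = 0 then inverse (2 ^ n) else 1) * abv (qint (b ?t))"
      by (simp add: d_def abv_mult abv_inverse abv_hop_weight degree_abs_y_par)
    ultimately have "abv d * weight n t = abv (qint (b ?t)) * weight n s / 2"
      by (simp add: t(1) ab(1) weight_def power_int_add power_int_diff)
    also have "\<dots> \<le> 1 * weight n s / 2"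
      using v st weight_pos[of s]
      by (intro divide_right_mono mult_right_mono abv_qint_le) (auto simp: valid_index_def)
    also have "\<dots> < 1 * weight n s" using weight_pos[of s] by simp
    finally show ?thesis using t(2) by simp
  qed (simp add: weight_pos)
  show ?thesis using act lead rest by blast
qed

lemma inj_move: "inj_on (move s t) A"
  by (rule inj_on_inverseI[where g = "move t s"]) simp

lemma leading_moves_act:
  "leading_moves abv (basis n \<kappa> l \<times> basis n \<kappa> m) (weight n) (EF_generators n)
     (\<lambda>g. act (gen g)) (move_domain n \<kappa>) (move_pair n) move_scale"
proof (intro leading_moves.intro leading_moves_axioms.intro)
  show "nonarch_abs (degree_abs (2 ^ n) :: ground \<Rightarrow> real)" ..
  show "finite (basis n \<kappa> l \<times> basis n \<kappa> m)" by (simp add: finite_basis)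
  show "0 < weight n s" for s by (rule weight_pos)
  show "plinear (act (gen g))" for g by (rule plinear_tensor_action)
  fix g assume "g \<in> EF_generators n"
  then consider i where "g = E i" "i < n" | i where "g = F i" "i < n"
    by (auto simp: EF_generators_def)
  note g = this
  show "0 < move_scale g" using g by cases simp_all
  show "inj_on (move_pair n g) ((basis n \<kappa> l \<times> basis n \<kappa> m) \<inter> move_domain n \<kappa> g)"
    using g by cases (auto intro!: inj_onI dest!: inj_onD[OF inj_move[where A = UNIV]])
  show "\<exists>c R. act (gen g) (Poly_Mapping.single s 1) =
      (if s \<in> move_domain n \<kappa> g then Poly_Mapping.single (move_pair n g s) c else 0) + R \<and>
      (s \<in> move_domain n \<kappa> g \<longrightarrow>
        abv c * weight n (move_pair n g s) = move_scale g * weight n s) \<and>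
      (\<forall>t. abv (Poly_Mapping.lookup R t) * weight n t < move_scale g * weight n s)"
    if "s \<in> basis n \<kappa> l \<times> basis n \<kappa> m" for s
    using g act_single_E[OF _ that] act_single_F[OF _ that] by cases (simp_all only: move_scale.simps)
qed

text \<open>Contracting uses \<open>e\<^sub>i\<close> to move the second index up and \<open>f\<^sub>i\<close> to move the first one down.
  Conversely \<open>e\<^sub>i\<close> reaches a second index \<open>b\<close> from the index obtained by moving \<open>b\<close> down, and
  \<open>f\<^sub>i\<close> reaches a first index from the one obtained by moving it up, so the roles of up and down
  are exchanged between \<open>P\<close> and \<open>Q\<close>.\<close>

lemma invariant_subspace_full:
  assumes U: "pm.subspace U" "U \<subseteq> tensor_space (W_space n \<kappa> l) (W_space n \<kappa> m)"
      "\<And>g u. g \<in> generators n \<Longrightarrow> u \<in> U \<Longrightarrow> act (gen g) u \<in> U" and nz: "U \<noteq> {0}"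
  shows "U = tensor_space (W_space n \<kappa> l) (W_space n \<kappa> m)"
proof -
  let ?B = "basis n \<kappa> l \<times> basis n \<kappa> m"
  let ?s0 = "(top_index n l, top_index n m)"
  interpret leading_moves abv ?B "weight n" "EF_generators n" "\<lambda>g. act (gen g)" "move_domain n \<kappa>"
    "move_pair n" move_scale by (rule leading_moves_act)
  define P Q where "P s = nat (down_steps n (fst s) + up_steps n (snd s))"
    and "Q s = nat (up_steps n (fst s) + down_steps n (snd s))" for s
  have P_E: "P (move_pair n (E i) t) < P t"
    if i: "i \<in> {1..<n}" and dom: "t \<in> ?B \<inter> move_domain n \<kappa> (E i)" for i t
  proof -
    obtain a b where t: "t = (a, b)" "a \<in> basis n \<kappa> l" "b \<in> basis n \<kappa> m" using dom by blast
    have p: "pos n i = i" "pos n (Suc i) = Suc i" using i by (auto simp: pos_eq)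
    hence "move i (Suc i) b \<in> basis n \<kappa> m"
      using i dom t by (intro move_in_basis) auto
    thus ?thesis
      using steps_nonneg(2)[OF t(2)] steps_nonneg(1) up_steps_move[OF i, of b] p
      by (fastforce simp: P_def t(1))
  qed
  have P_F: "P (move_pair n (F i) t) < P t"
    if i: "i < n - 1" and dom: "t \<in> ?B \<inter> move_domain n \<kappa> (F i)" for i t
  proof -
    obtain a b where t: "t = (a, b)" "a \<in> basis n \<kappa> l" "b \<in> basis n \<kappa> m" using dom by blast
    have p: "i < n" "pos n (Suc i) = Suc i" using i by (auto simp: pos_eq)
    hence "move (Suc i) (pos n i) a \<in> basis n \<kappa> l"
      using dom t pos_in_range(1)[OF p(1)] by (intro move_in_basis) auto
    thus ?thesis
      using steps_nonneg(1)[OF t(3)] steps_nonneg(2) down_steps_move[OF i, of a] p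
      by (fastforce simp: P_def t(1))
  qed
  have "U = {v. Poly_Mapping.keys v \<subseteq> ?B}"
  proof (rule invariant_subspace_eq_all[where P = P and Q = Q and ?s0.0 = ?s0, OF U(1) _ _ nz])
    show "Poly_Mapping.keys v \<subseteq> ?B" if "v \<in> U" for v using that U(2) keys_tensor_space by blast
    show "act (gen g) v \<in> U" if "g \<in> EF_generators n" "v \<in> U" for g v
      using that U(3) by (auto simp: EF_generators_def generators_def)
  next
    fix s assume s: "s \<in> ?B" "s \<noteq> ?s0"
    then obtain a b where ab: "s = (a, b)" "a \<in> basis n \<kappa> l" "b \<in> basis n \<kappa> m" by blast
    show "\<exists>g\<in>EF_generators n. s \<in> move_domain n \<kappa> g \<and>
        (\<forall>t\<in>?B \<inter> move_domain n \<kappa> g. P (move_pair n g t) < P t)"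
    proof (cases "b = top_index n m")
      case False
      then obtain i where i: "i \<in> {1..<n}" "move i (Suc i) b \<in> basis n \<kappa> m"
        using ex_move_up[OF ab(3) _ \<kappa>] by blast
      hence "s \<in> move_domain n \<kappa> (E i)" "E i \<in> EF_generators n"
        by (auto simp: ab(1) pos_eq basis_def EF_generators_def)
      thus ?thesis using P_E[OF i(1)] by blast
    next
      case True
      then obtain i where i: "i < n - 1" "move (Suc i) (pos n i) a \<in> basis n \<kappa> l"
        using ex_move_down[OF ab(2) _ \<kappa>] s(2) ab(1) by blast
      hence "s \<in> move_domain n \<kappa> (F i)" "F i \<in> EF_generators n"
        by (auto simp: ab(1) pos_eq(2)[of i n] basis_def EF_generators_def)
      thus ?thesis using P_F[OF i(1)] by blast
    qed
  next
    fix t assume t: "t \<in> ?B" "t \<noteq> ?s0"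
    then obtain a b where ab: "t = (a, b)" "a \<in> basis n \<kappa> l" "b \<in> basis n \<kappa> m" by blast
    show "\<exists>g\<in>EF_generators n. \<exists>s\<in>?B \<inter> move_domain n \<kappa> g. move_pair n g s = t \<and> Q s < Q t"
    proof (cases "b = top_index n m")
      case False
      then obtain i where i: "i < n - 1" "move (Suc i) (pos n i) b \<in> basis n \<kappa> m"
        using ex_move_down[OF ab(3) _ \<kappa>] by blast
      let ?s = "(a, move (Suc i) (pos n i) b)"
      have "i < n" and p: "pos n (Suc i) = Suc i" using i by (auto simp: pos_eq)
      hence "E i \<in> EF_generators n" "?s \<in> ?B \<inter> move_domain n \<kappa> (E i)" "move_pair n (E i) ?s = t"
        using i ab by (auto simp: basis_def EF_generators_def)
      moreover have "Q ?s < Q t"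
        using steps_nonneg(1)[OF ab(2)] steps_nonneg(2)[OF i(2)] down_steps_move[OF i(1), of b]
        by (simp add: Q_def ab(1))
      ultimately show ?thesis by blast
    next
      case True
      then obtain i where i: "i \<in> {1..<n}" "move i (Suc i) a \<in> basis n \<kappa> l"
        using ex_move_up[OF ab(2) _ \<kappa>] t(2) ab(1) by blast
      let ?s = "(move i (Suc i) a, b)"
      have p: "pos n i = i" "pos n (Suc i) = Suc i" using i(1) by (auto simp: pos_eq)
      hence "F i \<in> EF_generators n" "?s \<in> ?B \<inter> move_domain n \<kappa> (F i)" "move_pair n (F i) ?s = t"
        using i ab by (auto simp: basis_def EF_generators_def)
      moreover have "Q ?s < Q t"
        using steps_nonneg(2)[OF ab(3)] steps_nonneg(1)[OF i(2)] up_steps_move[OF i(1), of a]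
        by (simp add: Q_def ab(1))
      ultimately show ?thesis by blast
    qed
  qed
  thus ?thesis using U(2) keys_tensor_space by blast
qed

theorem UA_irreducible_tensor:
  "UA_irreducible n (ones_zeros \<kappa>) act (tensor_space (W_space n \<kappa> l) (W_space n \<kappa> m))"
  unfolding UA_irreducible_def
proof (intro conjI allI impI)
  let ?V = "tensor_space (W_space n \<kappa> l) (W_space n \<kappa> m)"
  show "UA_module n (ones_zeros \<kappa>) act ?V"
    by (rule UA_module_tensor)
  let ?u = "ket n \<kappa> (top_index n l)" and ?w = "ket n \<kappa> (top_index n m)"
  have "?u \<in> W_space n \<kappa> l" "?w \<in> W_space n \<kappa> m"
    unfolding W_space_eq_span using top_index_in_basis[OF \<kappa>] by (auto intro: pm.span_base)
  hence "tensor ?u ?w \<in> ?V" by (rule tensor_space_memI)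
  moreover have "Poly_Mapping.lookup (tensor ?u ?w) (top_index n l, top_index n m) = 1"
    using top_index_in_basis[OF \<kappa>] unfolding lookup_tensor_ket by (auto simp: basis_def)
  hence "tensor ?u ?w \<noteq> 0" by force
  ultimately show "?V \<noteq> {0}" by blast
  fix U assume "UA_submodule n act ?V U"
  hence U: "pm.subspace U" "U \<subseteq> ?V" "\<And>g u. g \<in> generators n \<Longrightarrow> u \<in> U \<Longrightarrow> act (gen g) u \<in> U"
    using free_algebra_gen by (auto simp: UA_submodule_def)
  show "U = {0} \<or> U = ?V"
    using invariant_subspace_full[OF U] by blast
qed

end

theorem proposition6p11:
  fixes n \<kappa> l m :: nat
  assumes "2 \<le> n" and "\<kappa> \<le> n - 2"
  shows "UA_irreducible n (ones_zeros \<kappa>)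
           (tensor_action (pi_rep n \<kappa> x_par) (pi_rep n \<kappa> y_par))
           (tensor_space (W_space n \<kappa> l) (W_space n \<kappa> m))"
  using assms by (intro UA_irreducible_tensor) simp_all

end
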